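(* Let $f:\mathbb{R}^n\to\overline{\mathbb{R}}$ be proper, lower semicontinuous and prox-bounded, let $\bar x\in\operatorname{dom} f$ and $\bar v\in\partial f(\bar x)$. Then the following statements are equivalent: (i) $f$ is variationally convex at $\bar x$ for $\bar v\in\partial f(\bar x)$. (ii) $f$ is prox-regular at $\bar x$ for $\bar v$, and for all sufficiently small $\lambda>0$ there exist open convex neighborhoods $U$ of $\bar x$ and $V$ of $\bar v$ such that, for every $(x,v)\in\operatorname{gph}\partial (h_\lambda f)\cap[U\times V]$, $$(\forall z\in U)\quad h_\lambda f(z)\ge h_\lambda f(x)+\langle v,z-x\rangle .$$
   Context: $\overline{\mathbb{R}}=[-\infty,+\infty]$; $f$ is proper if $f>-\infty$ and $f\not\equiv+\infty$; $\operatorname{dom} f=\{x: f(x)<+\infty\}$. Limiting (Mordukhovich) subdifferential: for $\bar x\in\operatorname{dom}f$, the regular subdifferential is $\widehat\partial f(\bar x)=\{v:\liminf_{x\to\bar x,\,x\ne\bar x}\frac{f(x)-f(\bar x)-\langle v,x-\bar x\rangle}{\|x-\bar x\|}\ge0\}$, and $\partial f(\bar x)$ is the set of limits $v=\lim v_k$ with $v_k\in\widehat\partial f(x_k)$, $x_k\to\bar x$, $f(x_k)\to f(\bar x)$; $\partial f(x)=\emptyset$ for $x\notin\operatorname{dom}f$. $\operatorname{gph}\partial f=\{(x,v): v\in\partial f(x)\}$. Moreau envelope: $e_\lambda f(x)=\inf_{w}\{f(w)+\frac1{2\lambda}\|w-x\|^2\}$, $\lambda>0$. Proximal hull: $h_\lambda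 f(x)=\sup_{w}\{e_\lambda f(w)-\frac1{2\lambda}\|w-x\|^2\}$. $f$ is prox-bounded if there exists $\lambda>0$ such that $e_\lambda f(x)>-\infty$ for some $x\in\mathbb{R}^n$. Prox-regularity: a proper lsc $f$ is prox-regular at $\bar x\in\operatorname{dom}f$ for $\bar v\in\partial f(\bar x)$ if there exist $\varepsilon>0$ and $r\ge0$ such that for every $(x,v)\in\operatorname{gph}\partial f$ with $\|x-\bar x\|<\varepsilon$, $f(x)<f(\bar x)+\varepsilon$, $\|v-\bar v\|<\varepsilon$, one has $f(x')\ge f(x)+\langle v,x'-x\rangle-\frac r2\|x'-x\|^2$ for all $x'$ with $\|x'-\bar x\|<\varepsilon$. Variational convexity: a proper lsc $f$ is variationally convex at $\bar x\in\operatorname{dom}f$ for $\bar v\in\partial f(\bar x)$ if there exist open convex neighborhoods $U$ of $\bar x$ and $V$ of $\bar v$, a convex lsc function $\hat f:\mathbb{R}^n\to\overline{\mathbb{R}}$ with $\hat f\le f$ on $U$, and $\varepsilon>0$ such that $[U_\varepsilon\times V]\cap\operatorname{gph}\partial f=[U\times V]\cap\operatorname{gph}\partial\hat f$, where $U_\varepsilon=\{x\in U: f(x)<f(\bar x)+\varepsilon\}$, and moreover $f(x)=\hat f(x)$ for every $(x,v)$ in this common graph. *)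

theory Defs
  imports "HOL-Analysis.Analysis"
begin

definition proper :: "('a \<Rightarrow> ereal) \<Rightarrow> bool" where
  "proper f \<longleftrightarrow> (\<forall>x. f x > -\<infinity>) \<and> (\<exists>x. f x \<noteq> \<infinity>)"

definition edom :: "('a \<Rightarrow> ereal) \<Rightarrow> 'a set" where
  "edom f = {x. f x < \<infinity>}"

definition lsc :: "('a::topological_space \<Rightarrow> ereal) \<Rightarrow> bool" where
  "lsc f \<longleftrightarrow> (\<forall>x. f x \<le> Liminf (at x) f)"

text \<open>In \<^typ>\<open>ereal\<close> one has \<open>\<infinity> + (-\<infinity>) = \<infinity>\<close>, which is the inf-addition convention under which
  Jensen's inequality expresses convexity (of the epigraph) also for improper functions.\<close>

definition convex_ext :: "('a::real_vector \<Rightarrow> ereal) \<Rightarrow> bool" where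
  "convex_ext f \<longleftrightarrow> (\<forall>x y t. 0 < t \<and> t < 1 \<longrightarrow>
     f ((1 - t) *\<^sub>R x + t *\<^sub>R y) \<le> ereal (1 - t) * f x + ereal t * f y)"

text \<open>The difference quotient is meaningful only where \<open>f\<close> is finite. Hence both subdifferentials
  are empty not only outside \<^term>\<open>edom f\<close> but also where \<open>f\<close> takes the value \<open>-\<infinity>\<close>, which concerns
  improper functions only.\<close>

definition regular_subdiff :: "('a::real_inner \<Rightarrow> ereal) \<Rightarrow> 'a \<Rightarrow> 'a set" where
  "regular_subdiff f x = {v. x \<in> edom f \<and> f x \<noteq> -\<infinity> \<and>
     Liminf (at x) (\<lambda>y. (f y - f x - ereal (v \<bullet> (y - x))) / ereal (norm (y - x))) \<ge> 0}"

definition subdiff :: "('a::real_inner \<Rightarrow> ereal) \<Rightarrow> 'a \<Rightarrow> 'a set" where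
  "subdiff f x = {v. x \<in> edom f \<and> f x \<noteq> -\<infinity> \<and>
     (\<exists>xs vs. (\<forall>k::nat. vs k \<in> regular_subdiff f (xs k)) \<and>
        xs \<longlonglongrightarrow> x \<and> (\<lambda>k. f (xs k)) \<longlonglongrightarrow> f x \<and> vs \<longlonglongrightarrow> v)}"

definition gph_subdiff :: "('a::real_inner \<Rightarrow> ereal) \<Rightarrow> ('a \<times> 'a) set" where
  "gph_subdiff f = {(x, v). v \<in> subdiff f x}"

definition moreau_env :: "real \<Rightarrow> ('a::real_normed_vector \<Rightarrow> ereal) \<Rightarrow> 'a \<Rightarrow> ereal" where
  "moreau_env l f x = (INF w. f w + ereal (1 / (2 * l) * (norm (w - x))\<^sup>2))"

definition prox_hull :: "real \<Rightarrow> ('a::real_normed_vector \<Rightarrow> ereal) \<Rightarrow> 'a \<Rightarrow> ereal" where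
  "prox_hull l f x = (SUP w. moreau_env l f w - ereal (1 / (2 * l) * (norm (w - x))\<^sup>2))"

definition prox_bounded :: "('a::real_normed_vector \<Rightarrow> ereal) \<Rightarrow> bool" where
  "prox_bounded f \<longleftrightarrow> (\<exists>l>0. \<exists>x. moreau_env l f x > -\<infinity>)"

definition prox_regular :: "('a::real_inner \<Rightarrow> ereal) \<Rightarrow> 'a \<Rightarrow> 'a \<Rightarrow> bool" where
  "prox_regular f xb vb \<longleftrightarrow>
     proper f \<and> lsc f \<and> xb \<in> edom f \<and> vb \<in> subdiff f xb \<and>
     (\<exists>\<epsilon>>0. \<exists>r\<ge>0. \<forall>(x, v)\<in>gph_subdiff f.
        norm (x - xb) < \<epsilon> \<and> f x < f xb + ereal \<epsilon> \<and> norm (v - vb) < \<epsilon> \<longrightarrow>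
        (\<forall>x'. norm (x' - xb) < \<epsilon> \<longrightarrow>
           f x' \<ge> f x + ereal (v \<bullet> (x' - x)) - ereal (r / 2 * (norm (x' - x))\<^sup>2)))"

definition variationally_convex :: "('a::real_inner \<Rightarrow> ereal) \<Rightarrow> 'a \<Rightarrow> 'a \<Rightarrow> bool" where
  "variationally_convex f xb vb \<longleftrightarrow>
     proper f \<and> lsc f \<and> xb \<in> edom f \<and> vb \<in> subdiff f xb \<and>
     (\<exists>U V fh \<epsilon>. open U \<and> convex U \<and> xb \<in> U \<and> open V \<and> convex V \<and> vb \<in> V \<and>
        convex_ext fh \<and> lsc fh \<and> (\<forall>x\<in>U. fh x \<le> f x) \<and> \<epsilon> > 0 \<and>
        ({x \<in> U. f x < f xb + ereal \<epsilon>} \<times> V) \<inter> gph_subdiff f = (U \<times> V) \<inter> gph_subdiff fh \<and>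
        (\<forall>(x, v) \<in> (U \<times> V) \<inter> gph_subdiff fh. f x = fh x))"

end

theory Submission
  imports Defs
begin

text \<open>Write \<open>x + \<lambda>v = w\<close>. Then \<open>x\<close> is a proximal point of \<open>w\<close> exactly if \<open>v\<close> is a global proximal
  subgradient of \<open>f\<close> at \<open>x\<close> with modulus \<open>1/\<lambda>\<close>. Prox-regularity and prox-boundedness make the proximal
  map single-valued and Lipschitz near \<open>xb + \<lambda>vb\<close>, and there its graph is a common localization of the
  subdifferentials of \<open>f\<close> and of \<open>h = prox_hull \<lambda> f\<close>, on which \<open>f = h\<close>.
  If \<open>h\<close> lies locally above its tangents at this localized graph, their supremum is the convex
  function required by variational convexity; its localized graph is not larger by monotonicity.
  Conversely, for \<open>z\<close> near \<open>xb\<close> and \<open>p\<close> the proximal point of \<open>z + \<lambda>v\<close>, inserting the subgradient inequality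
  \<open>f p \<ge> f x + v \<bullet> (p - x)\<close> of variational convexity into
  \<open>h z \<ge> f p + \<bar>p - z - \<lambda>v\<bar>\<^sup>2 / (2\<lambda>) - \<lambda>\<bar>v\<bar>\<^sup>2 / 2\<close> gives \<open>h z \<ge> f x + v \<bullet> (z - x)\<close>.\<close>

section \<open>Global proximal subgradients and weak convexity\<close>

text \<open>The witness \<open>c\<close> forces \<open>g x\<close> to be finite and keeps the
  inequality free of differences of infinite values. For \<open>k = 0\<close> these are the
  subgradients of convex analysis.\<close>

definition prox_subgrad :: "real \<Rightarrow> ('a::real_inner \<Rightarrow> ereal) \<Rightarrow> 'a \<Rightarrow> 'a \<Rightarrow> bool" where
  "prox_subgrad k g x v \<longleftrightarrow> (\<exists>c. g x = ereal c \<and>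
     (\<forall>z. ereal (c + v \<bullet> (z - x) - k / 2 * (norm (z - x))\<^sup>2) \<le> g z))"

text \<open>Equivalently, \<open>g + k/2 |.|\<^sup>2\<close> is convex.\<close>

definition weakly_convex :: "real \<Rightarrow> ('a::real_inner \<Rightarrow> ereal) \<Rightarrow> bool" where
  "weakly_convex k g \<longleftrightarrow> (\<forall>x y t. 0 < t \<and> t < 1 \<longrightarrow>
     g ((1 - t) *\<^sub>R x + t *\<^sub>R y) \<le>
       ereal (1 - t) * g x + ereal t * g y + ereal (k / 2 * t * (1 - t) * (norm (y - x))\<^sup>2))"

lemma weakly_convex_0: "weakly_convex 0 g \<longleftrightarrow> convex_ext g"
  by (simp add: weakly_convex_def convex_ext_def flip: zero_ereal_def)

lemma prox_subgradD:
  assumes "prox_subgrad k g x v" "g x = ereal c" "g z = ereal d"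
  shows "c + v \<bullet> (z - x) - k / 2 * (norm (z - x))\<^sup>2 \<le> d"
  using assms by (auto simp: prox_subgrad_def simp flip: ereal_less_eq(3) elim: allE[of _ z])

text \<open>Divided by \<open>norm (y - x)\<close>, the quadratic error becomes a multiple of
  \<open>norm (y - x)\<close>, so it bounds the difference quotient from below by a function tending
  to 0.\<close>

lemma prox_subgrad_imp_regular_subdiff:
  fixes x :: "'a::euclidean_space"
  assumes "prox_subgrad k g x v"
  shows "v \<in> regular_subdiff g x"
proof -
  obtain c where c: "g x = ereal c"
    and le: "\<And>z. ereal (c + v \<bullet> (z - x) - k / 2 * (norm (z - x))\<^sup>2) \<le> g z"
    using assms by (auto simp: prox_subgrad_def)
  let ?q = "\<lambda>y. (g y - g x - ereal (v \<bullet> (y - x))) / ereal (norm (y - x))"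
  have "((\<lambda>y. - k / 2 * norm (y - x)) \<longlongrightarrow> - k / 2 * norm (x - x)) (at x)"
    by (intro tendsto_intros)
  from tendsto_ereal[OF this] have "((\<lambda>y. ereal (- k / 2 * norm (y - x))) \<longlongrightarrow> 0) (at x)"
    by (simp add: zero_ereal_def)
  then have "Liminf (at x) (\<lambda>y. ereal (- k / 2 * norm (y - x))) = 0"
    by (intro lim_imp_Liminf) auto
  moreover have "Liminf (at x) (\<lambda>y. ereal (- k / 2 * norm (y - x))) \<le> Liminf (at x) ?q"
  proof (rule Liminf_mono, unfold eventually_at_filter, intro always_eventually allI impI)
    fix y assume "y \<noteq> x"
    then have n: "norm (y - x) > 0" by simp
    show "ereal (- k / 2 * norm (y - x)) \<le> ?q y"
    proof (cases "g y")
      case (real d)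
      then have "- k / 2 * norm (y - x) * norm (y - x) \<le> d - c - v \<bullet> (y - x)"
        using le[of y] by (simp add: power2_eq_square)
      then have "- k / 2 * norm (y - x) \<le> (d - c - v \<bullet> (y - x)) / norm (y - x)"
        using n by (simp only: pos_le_divide_eq)
      then show ?thesis using n by (simp add: real c)
    next
      case MInf
      then show ?thesis using le[of y] by simp
    next
      case PInf
      then show ?thesis using n by (simp add: c)
    qed
  qed
  ultimately show ?thesis
    by (simp add: regular_subdiff_def edom_def c)
qed

lemma prox_subgrad_imp_subdiff:
  fixes x :: "'a::euclidean_space"
  assumes "prox_subgrad k g x v"
  shows "v \<in> subdiff g x"
  using prox_subgrad_imp_regular_subdiff[OF assms] unfolding subdiff_def
  by (intro CollectI conjI exI[of _ "\<lambda>_. x"] exI[of _ "\<lambda>_. v"]) (simp_all add: regular_subdiff_def)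

lemma regular_subdiffD:
  fixes x :: "'a::euclidean_space"
  assumes "v \<in> regular_subdiff g x" "g x = ereal c" "e > 0"
  shows "\<forall>\<^sub>F y in at x. ereal (c + v \<bullet> (y - x) - e * norm (y - x)) \<le> g y"
proof -
  have "ereal (- e) < Liminf (at x) (\<lambda>y. (g y - g x - ereal (v \<bullet> (y - x))) / ereal (norm (y - x)))"
    using assms by (auto simp: regular_subdiff_def intro: less_le_trans[of _ 0])
  then have "\<forall>\<^sub>F y in at x. ereal (- e) < (g y - g x - ereal (v \<bullet> (y - x))) / ereal (norm (y - x))"
    by (rule less_LiminfD)
  moreover have "\<forall>\<^sub>F y in at x. y \<noteq> x" by (simp add: eventually_at_filter)
  ultimately show ?thesis
  proof eventually_elim
    case (elim y)
    then have n: "norm (y - x) > 0" by simp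
    show ?case
    proof (cases "g y")
      case (real d)
      then have "- e < (d - c - v \<bullet> (y - x)) / norm (y - x)"
        using elim(1) n by (simp add: assms(2))
      then have "- e * norm (y - x) < d - c - v \<bullet> (y - x)"
        using n by (simp only: pos_less_divide_eq)
      then show ?thesis by (simp add: real)
    next
      case MInf
      then show ?thesis using elim(1) n by (simp add: assms(2))
    qed simp
  qed
qed

text \<open>Weak convexity along the segment from \<open>x\<close> to \<open>z\<close> carries the
  first-order lower bound from a point close to \<open>x\<close> out to \<open>z\<close>, at a loss
  of \<open>e * n\<close> with \<open>e\<close> arbitrary.\<close>

lemma regular_subdiff_imp_prox_subgrad:
  fixes x :: "'a::euclidean_space"
  assumes "weakly_convex k g" "v \<in> regular_subdiff g x"
  shows "prox_subgrad k g x v"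
proof -
  obtain c where c: "g x = ereal c"
    using assms(2) by (cases "g x") (simp_all add: regular_subdiff_def edom_def)
  have "ereal (c + v \<bullet> (z - x) - k / 2 * (norm (z - x))\<^sup>2) \<le> g z" for z
  proof (cases "z = x \<or> g z = \<infinity>")
    case False
    define n where "n = norm (z - x)"
    have n: "n > 0" using False by (simp add: n_def)
    have main: "\<exists>d. g z = ereal d \<and> c + v \<bullet> (z - x) - e * n - k / 2 * n\<^sup>2 \<le> d" if "e > 0" for e
    proof -
      obtain s where s: "s > 0" and near: "\<And>y. y \<noteq> x \<Longrightarrow> dist y x < s \<Longrightarrow>
          ereal (c + v \<bullet> (y - x) - e / 2 * norm (y - x)) \<le> g y"
        using regular_subdiffD[OF assms(2) c, of "e / 2"] \<open>e > 0\<close> by (auto simp: eventually_at)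
      \<comment> \<open>The three bounds keep \<open>t\<close> below 1, keep \<open>?y\<close>
        within distance \<open>s\<close> of \<open>x\<close>, and limit the term caused by the
        factor \<open>1 - t\<close> in the quadratic error. The last one matters for negative
        \<open>k\<close>.\<close>
      define t where "t = Min {1 / 2, s / (2 * n), e / ((\<bar>k\<bar> + 1) * n)}"
      have t: "0 < t" "t < 1" "t * n < s" and tk: "t * ((\<bar>k\<bar> + 1) * n) \<le> e"
      proof -
        show "0 < t" using n s that by (auto simp: t_def)
        have "t \<le> 1/2" unfolding t_def by (rule Min_le) auto
        then show "t < 1" by simp
        have "t \<le> s / (2 * n)" unfolding t_def by (rule Min_le) auto
        then have "t * n \<le> s / 2" using n by (simp add: field_simps)
        then show "t * n < s" using s by simp
        have "t \<le> e / ((\<bar>k\<bar> + 1) * n)" unfolding t_def by (rule Min_le) auto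
        then show "t * ((\<bar>k\<bar> + 1) * n) \<le> e" using n by (simp add: pos_le_divide_eq)
      qed
      let ?y = "(1 - t) *\<^sub>R x + t *\<^sub>R z"
      have y: "?y - x = t *\<^sub>R (z - x)" by (simp add: algebra_simps)
      have "dist ?y x = t * n" using t by (simp add: dist_norm y n_def)
      moreover have "?y \<noteq> x" using False t y by auto
      ultimately have lo: "ereal (c + t * (v \<bullet> (z - x)) - e / 2 * (t * n)) \<le> g ?y"
        using near[of ?y] t by (simp add: y n_def)
      have up: "g ?y \<le> ereal (1 - t) * g x + ereal t * g z + ereal (k / 2 * t * (1 - t) * n\<^sup>2)"
        using assms(1) t by (simp add: weakly_convex_def n_def)
      have lu: "ereal (c + t * (v \<bullet> (z - x)) - e / 2 * (t * n)) \<le>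
          ereal (1 - t) * g x + ereal t * g z + ereal (k / 2 * t * (1 - t) * n\<^sup>2)"
        using lo up by (rule order_trans)
      \<comment> \<open>The value \<open>-\<infinity>\<close> for \<open>g z\<close> would make the
        right-hand side of \<open>lu\<close> equal to \<open>-\<infinity>\<close>, while its
        left-hand side is real.\<close>
      then obtain d where d: "g z = ereal d"
        using False t by (cases "g z") (auto simp: c)
      have "c + t * (v \<bullet> (z - x)) - e / 2 * (t * n) \<le> (1 - t) * c + t * d + k / 2 * t * (1 - t) * n\<^sup>2"
        using lu by (simp add: c d)
      then have "t * (c + v \<bullet> (z - x) - e / 2 * n - k / 2 * (1 - t) * n\<^sup>2) \<le> t * d"
        by (simp add: algebra_simps)
      then have 1: "c + v \<bullet> (z - x) - e / 2 * n - k / 2 * (1 - t) * n\<^sup>2 \<le> d"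
        using t by simp
      have "- k * t * n \<le> (\<bar>k\<bar> + 1) * t * n"
        using t n by (intro mult_right_mono) auto
      also have "\<dots> \<le> e" using tk by (simp add: algebra_simps)
      finally have "- k * t * n * n \<le> e * n" using n by (intro mult_right_mono) auto
      moreover have "c + v \<bullet> (z - x) \<le> d + e * n / 2 + k / 2 * n\<^sup>2 - k * t * n * n / 2"
        using 1 by (simp add: field_simps power2_eq_square)
      ultimately have "c + v \<bullet> (z - x) - e * n - k / 2 * n\<^sup>2 \<le> d" by linarith
      with d show ?thesis by blast
    qed
    obtain d where d: "g z = ereal d" using main[of 1] by auto
    have "c + v \<bullet> (z - x) - k / 2 * n\<^sup>2 \<le> d"
    proof (rule field_le_epsilon)
      fix e :: real assume "e > 0"
      then show "c + v \<bullet> (z - x) - k / 2 * n\<^sup>2 \<le> d + e"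
        using main[of "e / n"] n d by auto
    qed
    then show ?thesis by (simp add: d n_def)
  qed (auto simp: c)
  with c show ?thesis by (auto simp: prox_subgrad_def)
qed

text \<open>The inequality for regular subgradients is global and has the same \<open>k\<close> at
  every \<open>xs j\<close>, so it passes to the limit in the points, the values and the
  subgradients. Limiting and regular subgradients thus agree for weakly convex functions.\<close>

lemma subdiff_imp_prox_subgrad:
  fixes x :: "'a::euclidean_space"
  assumes "weakly_convex k g" "v \<in> subdiff g x"
  shows "prox_subgrad k g x v"
proof -
  obtain c where c: "g x = ereal c"
    using assms(2) by (cases "g x") (simp_all add: subdiff_def edom_def)
  obtain xs vs where reg: "\<And>j::nat. vs j \<in> regular_subdiff g (xs j)"
    and lim: "xs \<longlonglongrightarrow> x" "(\<lambda>j. g (xs j)) \<longlonglongrightarrow> g x" "vs \<longlonglongrightarrow> v"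
    using assms(2) by (auto simp: subdiff_def)
  obtain cs where cs: "\<And>j. g (xs j) = ereal (cs j)"
    and le: "\<And>j z. ereal (cs j + vs j \<bullet> (z - xs j) - k / 2 * (norm (z - xs j))\<^sup>2) \<le> g z"
    using regular_subdiff_imp_prox_subgrad[OF assms(1) reg] unfolding prox_subgrad_def by metis
  have cl: "cs \<longlonglongrightarrow> c" using lim(2) by (simp add: cs c)
  have "ereal (c + v \<bullet> (z - x) - k / 2 * (norm (z - x))\<^sup>2) \<le> g z" for z
  proof (rule LIMSEQ_le_const2)
    show "(\<lambda>j. ereal (cs j + vs j \<bullet> (z - xs j) - k / 2 * (norm (z - xs j))\<^sup>2))
        \<longlonglongrightarrow> ereal (c + v \<bullet> (z - x) - k / 2 * (norm (z - x))\<^sup>2)"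
      unfolding tendsto_ereal by (intro tendsto_intros cl lim)
  qed (use le in auto)
  with c show ?thesis by (auto simp: prox_subgrad_def)
qed

lemma subdiff_iff_prox_subgrad:
  fixes x :: "'a::euclidean_space"
  assumes "weakly_convex k g"
  shows "v \<in> subdiff g x \<longleftrightarrow> prox_subgrad k g x v"
  using subdiff_imp_prox_subgrad[OF assms] prox_subgrad_imp_subdiff by blast

section \<open>Lower semicontinuity of extended real functions\<close>

text \<open>\<open>Liminf (at x)\<close> ignores the point \<open>x\<close> itself; the inequality
  at \<open>x\<close> is added to obtain a full neighbourhood.\<close>

lemma lsc_iff_open: "lsc f \<longleftrightarrow> (\<forall>a. open {x. a < f x})"
proof
  assume l: "lsc f"
  show "\<forall>a. open {x. a < f x}"
  proof
    fix a
    have "\<forall>\<^sub>F y in nhds x. a < f y" if "a < f x" for x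
    proof -
      have "a < Liminf (at x) f" using l that by (auto simp: lsc_def intro: less_le_trans)
      from less_LiminfD[OF this] show ?thesis using that by (simp add: eventually_nhds_conv_at)
    qed
    then have nb: "\<exists>T. open T \<and> x \<in> T \<and> T \<subseteq> {x. a < f x}" if "a < f x" for x
      using that unfolding eventually_nhds by (metis mem_Collect_eq subsetI)
    show "open {x. a < f x}"
      by (subst open_subopen) (intro ballI nb, simp)
  qed
next
  assume o: "\<forall>a. open {x. a < f x}"
  have "\<forall>\<^sub>F y in at x. a < f y" if "a < f x" for a x
  proof -
    have "\<forall>\<^sub>F y in nhds x. y \<in> {x. a < f x}"
      by (rule eventually_nhds_in_open) (use o that in auto)
    then show ?thesis by (simp add: eventually_nhds_conv_at)
  qed
  then show "lsc f" unfolding lsc_def le_Liminf_iff by blast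
qed

lemma lsc_SUP:
  assumes "\<And>i. i \<in> I \<Longrightarrow> lsc (F i)"
  shows "lsc (\<lambda>z. SUP i\<in>I. F i z)"
  unfolding lsc_iff_open
proof
  fix a
  have eq: "{x. a < (SUP i\<in>I. F i x)} = (\<Union>i\<in>I. {x. a < F i x})"
    by (auto simp: less_SUP_iff)
  have "open {x. a < F i x}" if "i \<in> I" for i
    using assms[OF that] by (simp add: lsc_iff_open)
  then show "open {x. a < (SUP i\<in>I. F i x)}"
    unfolding eq by (intro open_UN ballI)
qed

lemma lsc_ereal:
  assumes "continuous_on UNIV g"
  shows "lsc (\<lambda>x. ereal (g x))"
  unfolding lsc_iff_open
proof
  fix a :: ereal
  show "open {x. a < ereal (g x)}"
  proof (cases a)
    case (real r)
    have "open {x. r < g x}" by (rule open_Collect_less[OF continuous_on_const assms])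
    then show ?thesis by (simp add: real)
  qed simp_all
qed

lemma lsc_add_continuous:
  assumes "lsc f" "continuous_on UNIV g"
  shows "lsc (\<lambda>x. f x + ereal (g x))"
  unfolding lsc_iff_open
proof
  fix a :: ereal
  \<comment> \<open>An intermediate value \<open>b\<close> separates the two summands, so that only
    superlevel sets of \<open>f\<close> and of \<open>g\<close> occur, also where \<open>f\<close>
    is infinite.\<close>
  have eq: "{x. a < f x + ereal (g x)} = (\<Union>b. {x. b < f x} \<inter> {x. a < b + ereal (g x)})"
  proof (intro equalityI subsetI)
    fix x assume "x \<in> {x. a < f x + ereal (g x)}"
    then have "a - ereal (g x) < f x"
      by (cases a; cases "f x") auto
    then obtain b where b: "a - ereal (g x) < b" "b < f x" using dense by blast
    then have "a < b + ereal (g x)" by (cases a; cases b) auto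
    with b show "x \<in> (\<Union>b. {x. b < f x} \<inter> {x. a < b + ereal (g x)})" by blast
  next
    fix x assume "x \<in> (\<Union>b. {x. b < f x} \<inter> {x. a < b + ereal (g x)})"
    then obtain b where "b < f x" "a < b + ereal (g x)" by blast
    moreover have "b + ereal (g x) \<le> f x + ereal (g x)"
      using \<open>b < f x\<close> by (intro add_right_mono) simp
    ultimately show "x \<in> {x. a < f x + ereal (g x)}"
      by simp
  qed
  have "open {x. b < f x}" for b using assms(1) by (simp add: lsc_iff_open)
  moreover have "open {x. a < b + ereal (g x)}" for b
  proof (cases b)
    case (real r)
    have "lsc (\<lambda>x. ereal (r + g x))"
      using assms(2) by (intro lsc_ereal continuous_on_add continuous_on_const)
    then show ?thesis by (simp add: real lsc_iff_open)
  next
    case PInf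
    then show ?thesis by (cases "a = \<infinity>") simp_all
  qed simp
  ultimately show "open {x. a < f x + ereal (g x)}"
    unfolding eq by (intro open_UN ballI open_Int)
qed

text \<open>If no point were minimal, the open sets \<open>{x. f y < f x}\<close> with
  \<open>y\<close> in \<open>K\<close> would cover \<open>K\<close>. In a finite subcover, the
  centre \<open>y\<close> with the least value \<open>f y\<close> lies in none of the sets.\<close>

lemma lsc_attains_inf:
  fixes f :: "'a::topological_space \<Rightarrow> ereal"
  assumes "lsc f" "compact K" "K \<noteq> {}"
  obtains x where "x \<in> K" "\<And>y. y \<in> K \<Longrightarrow> f x \<le> f y"
proof (rule ccontr)
  assume "\<not> thesis"
  then have "\<forall>x\<in>K. \<exists>y\<in>K. f y < f x" using that by (meson not_le)
  then have cov: "K \<subseteq> (\<Union>y\<in>K. {x. f y < f x})" by blast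
  obtain C where C: "C \<subseteq> K" "finite C" "K \<subseteq> (\<Union>y\<in>C. {x. f y < f x})"
    using compactE_image[OF assms(2) _ cov] assms(1) unfolding lsc_iff_open by metis
  have "C \<noteq> {}" using C assms(3) by auto
  then have "Min (f ` C) \<in> f ` C" using C by auto
  then obtain y where y: "y \<in> C" "f y = Min (f ` C)" by auto
  then obtain z where "z \<in> C" "f z < f y" using C by blast
  moreover have "f y \<le> f z" using y C \<open>z \<in> C\<close> by auto
  ultimately show False by simp
qed

section \<open>Suprema of quadratics with fixed negative curvature\<close>

lemma weakly_convex_SUP:
  assumes "\<And>i. i \<in> I \<Longrightarrow> weakly_convex k (F i)"
  shows "weakly_convex k (\<lambda>z. SUP i\<in>I. F i z)"
  unfolding weakly_convex_def
proof (intro allI impI SUP_least)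
  fix x y and t :: real and i assume t: "0 < t \<and> t < 1" and i: "i \<in> I"
  have "F i ((1 - t) *\<^sub>R x + t *\<^sub>R y) \<le> ereal (1 - t) * F i x + ereal t * F i y
      + ereal (k / 2 * t * (1 - t) * (norm (y - x))\<^sup>2)"
    using assms[OF i] t by (auto simp: weakly_convex_def)
  also have "\<dots> \<le> ereal (1 - t) * (SUP i\<in>I. F i x) + ereal t * (SUP i\<in>I. F i y)
      + ereal (k / 2 * t * (1 - t) * (norm (y - x))\<^sup>2)"
    using t i by (intro add_mono ereal_mult_left_mono SUP_upper) auto
  finally show "F i ((1 - t) *\<^sub>R x + t *\<^sub>R y) \<le> \<dots>" .
qed

lemma norm_convex_combination:
  fixes p q :: "'a::real_inner"
  shows "(norm ((1 - t) *\<^sub>R p + t *\<^sub>R q))\<^sup>2 =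
    (1 - t) * (norm p)\<^sup>2 + t * (norm q)\<^sup>2 - t * (1 - t) * (norm (q - p))\<^sup>2"
  by (simp add: power2_norm_eq_inner inner_simps inner_commute[of q p] algebra_simps)

text \<open>The curvature is cancelled exactly, so the defining inequality holds with equality. The
  case \<open>k = 0\<close> covers affine functions.\<close>

lemma weakly_convex_quadratic: "weakly_convex k (\<lambda>z. ereal (a + b \<bullet> z - k / 2 * (norm (z - w))\<^sup>2))"
  unfolding weakly_convex_def
proof (intro allI impI)
  fix x y :: 'a and t :: real assume "0 < t \<and> t < 1"
  have "(1 - t) *\<^sub>R x + t *\<^sub>R y - w = (1 - t) *\<^sub>R (x - w) + t *\<^sub>R (y - w)"
    by (simp add: algebra_simps)
  then have eq: "(norm ((1 - t) *\<^sub>R x + t *\<^sub>R y - w))\<^sup>2 =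
    (1 - t) * (norm (x - w))\<^sup>2 + t * (norm (y - w))\<^sup>2 - t * (1 - t) * (norm (y - x))\<^sup>2"
    by (simp add: norm_convex_combination)
  have "a + b \<bullet> ((1 - t) *\<^sub>R x + t *\<^sub>R y) - k / 2 * (norm ((1 - t) *\<^sub>R x + t *\<^sub>R y - w))\<^sup>2
     = (1 - t) * (a + b \<bullet> x - k / 2 * (norm (x - w))\<^sup>2) + t * (a + b \<bullet> y - k / 2 * (norm (y - w))\<^sup>2)
      + k / 2 * t * (1 - t) * (norm (y - x))\<^sup>2"
    unfolding eq by (simp add: inner_simps algebra_simps diff_divide_distrib)
  then show "ereal (a + b \<bullet> ((1 - t) *\<^sub>R x + t *\<^sub>R y) - k / 2 * (norm ((1 - t) *\<^sub>R x + t *\<^sub>R y - w))\<^sup>2)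
     \<le> ereal (1 - t) * ereal (a + b \<bullet> x - k / 2 * (norm (x - w))\<^sup>2) + ereal t * ereal (a + b \<bullet> y - k / 2 * (norm (y - w))\<^sup>2)
      + ereal (k / 2 * t * (1 - t) * (norm (y - x))\<^sup>2)"
    by simp
qed

section \<open>Moreau envelope and proximal hull at the centre
  \<open>x + l *\<^sub>R v\<close>\<close>

text \<open>Expanding the square around \<open>x\<close> turns the penalty of the envelope at
  \<open>x + l v\<close> into the linear and quadratic terms of a proximal subgradient inequality
  with modulus \<open>1 / l\<close>.\<close>

lemma prox_identity:
  fixes v x z :: "'a::real_inner"
  assumes "l \<noteq> 0"
  shows "1 / (2 * l) * (norm (x - (x + l *\<^sub>R v)))\<^sup>2 = l / 2 * (norm v)\<^sup>2"
    and "1 / (2 * l) * (norm (z - (x + l *\<^sub>R v)))\<^sup>2 =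
      l / 2 * (norm v)\<^sup>2 - v \<bullet> (z - x) + (1 / l) / 2 * (norm (z - x))\<^sup>2"
proof -
  show "1 / (2 * l) * (norm (x - (x + l *\<^sub>R v)))\<^sup>2 = l / 2 * (norm v)\<^sup>2"
    using assms by (simp add: power_mult_distrib) (simp add: power2_eq_square)
  have expand: "(norm (p - l *\<^sub>R v))\<^sup>2 = (norm p)\<^sup>2 - 2 * l * (v \<bullet> p) + l * l * (norm v)\<^sup>2" for p
    unfolding power2_norm_eq_inner
    by (simp add: inner_simps inner_commute[of p v] algebra_simps)
  have "(norm (z - (x + l *\<^sub>R v)))\<^sup>2 = (norm ((z - x) - l *\<^sub>R v))\<^sup>2"
    by (simp add: algebra_simps)
  also have "\<dots> = (norm (z - x))\<^sup>2 - 2 * l * (v \<bullet> (z - x)) + l * l * (norm v)\<^sup>2"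
    by (rule expand)
  finally show "1 / (2 * l) * (norm (z - (x + l *\<^sub>R v)))\<^sup>2 =
      l / 2 * (norm v)\<^sup>2 - v \<bullet> (z - x) + (1 / l) / 2 * (norm (z - x))\<^sup>2"
    using assms by (simp only:) (simp add: field_simps)
qed

text \<open>By \<open>prox_identity\<close>, the subgradient inequality says that no competitor
  \<open>z\<close> does better than \<open>x\<close> at the centre \<open>x + l v\<close>.\<close>

lemma prox_subgrad_moreau_env:
  assumes "0 < l" "prox_subgrad (1 / l) f x v" "f x = ereal c"
  shows "moreau_env l f (x + l *\<^sub>R v) = ereal (c + l / 2 * (norm v)\<^sup>2)"
  unfolding moreau_env_def
proof (rule antisym)
  show "(INF w. f w + ereal (1 / (2 * l) * (norm (w - (x + l *\<^sub>R v)))\<^sup>2)) \<le> ereal (c + l / 2 * (norm v)\<^sup>2)"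
    using assms prox_identity(1)[of l x v] by (intro INF_lower2[of x]) (auto simp del: norm_minus_cancel)
  show "ereal (c + l / 2 * (norm v)\<^sup>2) \<le> (INF w. f w + ereal (1 / (2 * l) * (norm (w - (x + l *\<^sub>R v)))\<^sup>2))"
  proof (rule INF_greatest)
    fix z
    have "ereal (c + v \<bullet> (z - x) - (1 / l) / 2 * (norm (z - x))\<^sup>2) \<le> f z"
      using assms by (auto simp: prox_subgrad_def)
    then show "ereal (c + l / 2 * (norm v)\<^sup>2) \<le> f z + ereal (1 / (2 * l) * (norm (z - (x + l *\<^sub>R v)))\<^sup>2)"
      using assms(1) prox_identity(2)[of l z x v] by (cases "f z") auto
  qed
qed

lemma moreau_env_le:
  assumes "f x = ereal c"
  shows "moreau_env l f w \<le> ereal (c + 1 / (2 * l) * (norm (x - w))\<^sup>2)"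
  unfolding moreau_env_def using assms by (intro INF_lower2[of x]) auto

lemma prox_hull_le:
  assumes "f x \<noteq> -\<infinity>"
  shows "prox_hull l f x \<le> f x"
  unfolding prox_hull_def
proof (rule SUP_least)
  fix w
  show "moreau_env l f w - ereal (1 / (2 * l) * (norm (w - x))\<^sup>2) \<le> f x"
  proof (cases "f x")
    case (real c)
    show ?thesis using moreau_env_le[of f x c l w, OF real]
      by (cases "moreau_env l f w") (auto simp: real norm_minus_commute)
  qed (use assms in auto)
qed

lemma le_prox_hull:
  "moreau_env l f w - ereal (1 / (2 * l) * (norm (w - x))\<^sup>2) \<le> prox_hull l f x"
  unfolding prox_hull_def by (rule SUP_upper) simp

text \<open>The term of the supremum at the centre \<open>x + l v\<close> is the quadratic minorant
  of \<open>f\<close> that touches \<open>f\<close> at \<open>x\<close>. The hull is squeezed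
  between this minorant and \<open>f\<close>.\<close>

lemma prox_subgrad_prox_hull:
  assumes "0 < l" "prox_subgrad (1 / l) f x v"
  shows "prox_hull l f x = f x" "prox_subgrad (1 / l) (prox_hull l f) x v"
proof -
  obtain c where c: "f x = ereal c" using assms by (auto simp: prox_subgrad_def)
  have le: "ereal (c + v \<bullet> (z - x) - (1 / l) / 2 * (norm (z - x))\<^sup>2) \<le> prox_hull l f z" for z
    using le_prox_hull[of l f "x + l *\<^sub>R v" z] prox_identity(2)[of l z x v] assms(1)
    by (simp add: prox_subgrad_moreau_env[OF assms c] norm_minus_commute[of _ z] add_diff_eq)
  moreover have "prox_hull l f x \<le> f x" by (rule prox_hull_le) (simp add: c)
  moreover have "f x \<le> prox_hull l f x" using le[of x] by (simp add: c)
  ultimately show "prox_hull l f x = f x" by simp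
  with le show "prox_subgrad (1 / l) (prox_hull l f) x v" by (auto simp: prox_subgrad_def c)
qed

text \<open>The left-hand value is the envelope of the hull at \<open>x + l v\<close>, and the hull
  lies below \<open>f\<close>.\<close>

lemma prox_subgrad_prox_hull_moreau_env:
  assumes "0 < l" "prox_subgrad (1 / l) (prox_hull l f) x v" "prox_hull l f x = ereal c"
    and "\<forall>z. f z \<noteq> -\<infinity>"
  shows "moreau_env l f (x + l *\<^sub>R v) \<ge> ereal (c + l / 2 * (norm v)\<^sup>2)"
proof -
  have "moreau_env l (prox_hull l f) (x + l *\<^sub>R v) \<le> moreau_env l f (x + l *\<^sub>R v)"
    unfolding moreau_env_def
    by (intro INF_mono) (metis UNIV_I add_right_mono assms(4) prox_hull_le)
  then show ?thesis using prox_subgrad_moreau_env[OF assms(1-3)] by simp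
qed

text \<open>Finite envelope values make the hull a supremum of real quadratics, all with the same
  curvature.\<close>

lemma weakly_convex_prox_hull:
  assumes "\<And>w. moreau_env l f w = ereal (E w)"
  shows "weakly_convex (1 / l) (prox_hull l f)"
proof -
  have "weakly_convex (1 / l) (\<lambda>z. SUP w. ereal (E w + 0 \<bullet> z - (1 / l) / 2 * (norm (z - w))\<^sup>2))"
    by (intro weakly_convex_SUP weakly_convex_quadratic)
  moreover have "prox_hull l f = (\<lambda>z. SUP w. ereal (E w + 0 \<bullet> z - (1 / l) / 2 * (norm (z - w))\<^sup>2))"
    by (rule ext) (simp add: prox_hull_def assms norm_minus_commute mult.commute[of l])
  ultimately show ?thesis by simp
qed

lemma prox_subgrad_0_mono:
  assumes "prox_subgrad 0 g x v" "prox_subgrad 0 g y w"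
  shows "0 \<le> (v - w) \<bullet> (x - y)"
proof -
  obtain c d where cd: "g x = ereal c" "g y = ereal d" using assms by (auto simp: prox_subgrad_def)
  show ?thesis
    using prox_subgradD[OF assms(1) cd] prox_subgradD[OF assms(2) cd(2,1)] by (simp add: inner_simps)
qed

lemma common_ball_radius:
  fixes x :: "'a::metric_space" and y :: "'b::metric_space"
  assumes "open U" "x \<in> U" "open V" "y \<in> V" "0 < b"
  obtains \<eta> where "0 < \<eta>" "\<eta> \<le> b" "ball x \<eta> \<subseteq> U" "ball y \<eta> \<subseteq> V"
proof -
  obtain s t where "0 < s" "ball x s \<subseteq> U" "0 < t" "ball y t \<subseteq> V"
    using assms open_contains_ball by metis
  with \<open>0 < b\<close> show ?thesis by (intro that[of "min b (min s t)"]) auto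
qed

lemma in_ball_norm: "x \<in> ball a s \<longleftrightarrow> norm (x - a) < s" for x a :: "'a::real_normed_vector"
  by (simp add: dist_norm norm_minus_commute)

section \<open>Existence, uniqueness and stability of proximal points\<close>

text \<open>\<open>glob\<close> controls all points \<open>z\<close> but only for the pair
  \<open>(xb, vb)\<close>, whereas \<open>pr\<close> treats all nearby pairs but only nearby
  \<open>z\<close>. The bound \<open>l * r < 1\<close> lets the penalty of the envelope dominate
  both quadratic errors.\<close>

locale prox_setting =
  fixes f :: "'a::euclidean_space \<Rightarrow> ereal" and xb vb :: 'a and cb e r l :: real
  assumes lsc: "lsc f" and fxb: "f xb = ereal cb" and e: "0 < e" and r: "0 \<le> r"
    and l: "0 < l" and lr: "l * r < 1"
    and glob: "\<And>z. ereal (cb + vb \<bullet> (z - xb) - r / 2 * (norm (z - xb))\<^sup>2) \<le> f z"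
    and pr: "\<And>x v c z. v \<in> subdiff f x \<Longrightarrow> norm (x - xb) < e \<Longrightarrow> f x < f xb + ereal e \<Longrightarrow>
      norm (v - vb) < e \<Longrightarrow> norm (z - xb) < e \<Longrightarrow> f x = ereal c \<Longrightarrow>
      ereal (c + v \<bullet> (z - x) - r / 2 * (norm (z - x))\<^sup>2) \<le> f z"
begin

lemma not_MInf: "f z \<noteq> -\<infinity>"
  using glob[of z] by auto

lemma prox_subgrad_xb: "prox_subgrad (1 / l) f xb vb"
proof -
  have "r / 2 * (norm (z - xb))\<^sup>2 \<le> (1 / l) / 2 * (norm (z - xb))\<^sup>2" for z
    using lr l by (intro mult_right_mono divide_right_mono) (auto simp: field_simps)
  then have "ereal (cb + vb \<bullet> (z - xb) - (1 / l) / 2 * (norm (z - xb))\<^sup>2) \<le> f z" for z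
    using glob[of z] by (intro order_trans[OF _ glob[of z]]) simp
  then show ?thesis using fxb by (auto simp: prox_subgrad_def)
qed

text \<open>Since \<open>x\<close> is not known to be near \<open>xb\<close>, its own inequality,
  taken at \<open>xb\<close>, is compared with \<open>glob\<close> at \<open>x\<close>. After
  multiplication by \<open>l\<close>, the quadratic terms leave \<open>(1 - l * r) / 2\<close> times
  \<open>norm y ^ 2\<close>, whence the factor 2.\<close>

lemma norm_prox_le:
  assumes "prox_subgrad (1 / l) f x v"
  shows "(1 - l * r) * norm (x - xb) \<le> 2 * norm (x + l *\<^sub>R v - (xb + l *\<^sub>R vb))"
proof -
  obtain c where c: "f x = ereal c" using assms by (auto simp: prox_subgrad_def)
  define y where "y = x - xb"
  define d where "d = x + l *\<^sub>R v - (xb + l *\<^sub>R vb)"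
  have 1: "c - v \<bullet> y - (1 / l) / 2 * (norm y)\<^sup>2 \<le> cb"
    using prox_subgradD[OF assms c fxb] by (simp add: y_def norm_minus_commute inner_simps)
  have 2: "cb + vb \<bullet> y - r / 2 * (norm y)\<^sup>2 \<le> c"
    using glob[of x] by (simp add: c y_def)
  have "l *\<^sub>R (v - vb) = d - y" by (simp add: d_def y_def algebra_simps)
  then have "l * ((v - vb) \<bullet> y) = d \<bullet> y - (norm y)\<^sup>2"
    by (metis inner_diff_left inner_scaleR_left power2_norm_eq_inner)
  then have 3: "l * (v \<bullet> y) - l * (vb \<bullet> y) = d \<bullet> y - (norm y)\<^sup>2"
    by (simp add: inner_simps algebra_simps)
  have "vb \<bullet> y - v \<bullet> y \<le> (1 / l) / 2 * (norm y)\<^sup>2 + r / 2 * (norm y)\<^sup>2" using 1 2 by linarith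
  then have "l * (vb \<bullet> y - v \<bullet> y) \<le> l * ((1 / l) / 2 * (norm y)\<^sup>2 + r / 2 * (norm y)\<^sup>2)"
    using l by (intro mult_left_mono) auto
  also have "\<dots> = (norm y)\<^sup>2 / 2 + l * r * (norm y)\<^sup>2 / 2" using l by (simp add: field_simps)
  finally have "(norm y)\<^sup>2 - d \<bullet> y \<le> (norm y)\<^sup>2 / 2 + l * r * (norm y)\<^sup>2 / 2"
    using 3 by (simp add: right_diff_distrib)
  then have "(1 - l * r) * (norm y)\<^sup>2 \<le> 2 * (d \<bullet> y)" by (simp add: algebra_simps)
  also have "\<dots> \<le> 2 * (norm d * norm y)" using norm_cauchy_schwarz[of d y] by simp
  finally have "((1 - l * r) * norm y) * norm y \<le> (2 * norm d) * norm y"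
    by (simp add: power2_eq_square mult.assoc)
  then show ?thesis unfolding y_def[symmetric] d_def[symmetric]
    by (cases "y = 0") (auto simp only: mult_le_cancel_right zero_less_norm_iff norm_zero mult_zero_right norm_ge_zero mult_nonneg_nonneg zero_le_numeral)
qed

text \<open>The bound on \<open>x\<close> is \<open>norm_prox_le\<close>, the one on
  \<open>v\<close> follows from \<open>l (v - vb) = d - (x - xb)\<close> with \<open>d\<close> the
  displacement of the centre, and the one on \<open>f x\<close> from the inequality of
  \<open>x\<close> taken at \<open>xb\<close>.\<close>

lemma prox_near:
  assumes "0 < \<eta>"
  shows "\<exists>\<delta>>0. \<forall>x v. prox_subgrad (1 / l) f x v \<and> norm (x + l *\<^sub>R v - (xb + l *\<^sub>R vb)) < \<delta> \<longrightarrow>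
    norm (x - xb) < \<eta> \<and> norm (v - vb) < \<eta> \<and> f x < f xb + ereal \<eta>"
proof -
  \<comment> \<open>If the centre moves by less than \<open>s\<close>, then \<open>M * s\<close>,
    \<open>N * s\<close> and \<open>?b s\<close> bound the distances of \<open>x\<close> and
    \<open>v\<close> and the increase of \<open>f\<close>. All three vanish as \<open>s\<close>
    tends to 0.\<close>
  define M where "M = 2 / (1 - l * r)"
  define N where "N = (1 + M) / l"
  have M: "0 < M" using lr by (simp add: M_def)
  let ?b = "\<lambda>s. (norm vb + N * s) * (M * s) + (1 / l) / 2 * (M * s)\<^sup>2"
  have "((\<lambda>s. M * s) \<longlongrightarrow> M * 0) (at_right 0)" "((\<lambda>s. N * s) \<longlongrightarrow> N * 0) (at_right 0)"
    "(?b \<longlongrightarrow> (norm vb + N * 0) * (M * 0) + (1 / l) / 2 * (M * 0)\<^sup>2) (at_right 0)"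
    by (intro tendsto_intros)+
  then have "\<forall>\<^sub>F s in at_right 0. M * s < \<eta>" "\<forall>\<^sub>F s in at_right 0. N * s < \<eta>" "\<forall>\<^sub>F s in at_right 0. ?b s < \<eta>"
    using assms by (auto dest: order_tendstoD(2))
  moreover have "\<forall>\<^sub>F s::real in at_right 0. 0 < s" by (simp add: eventually_at_right_less)
  ultimately have "\<forall>\<^sub>F s in at_right 0. 0 < s \<and> M * s < \<eta> \<and> N * s < \<eta> \<and> ?b s < \<eta>"
    by eventually_elim auto
  from eventually_happens'[OF trivial_limit_at_right_real this]
  obtain s where s: "0 < s" "M * s < \<eta>" "N * s < \<eta>" "?b s < \<eta>"
    by blast
  show ?thesis
  proof (intro exI[of _ s] conjI allI impI)
    fix x v assume "prox_subgrad (1 / l) f x v \<and> norm (x + l *\<^sub>R v - (xb + l *\<^sub>R vb)) < s"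
    then have ps: "prox_subgrad (1 / l) f x v" and lt: "norm (x + l *\<^sub>R v - (xb + l *\<^sub>R vb)) < s" by auto
    have "(1 - l * r) * norm (x - xb) \<le> 2 * s" using norm_prox_le[OF ps] lt by linarith
    then have xM: "norm (x - xb) \<le> M * s" using lr by (simp add: M_def field_simps)
    then show "norm (x - xb) < \<eta>" using s by simp
    have "l *\<^sub>R (v - vb) = (x + l *\<^sub>R v - (xb + l *\<^sub>R vb)) - (x - xb)" by (simp add: algebra_simps)
    then have "l * norm (v - vb) = norm ((x + l *\<^sub>R v - (xb + l *\<^sub>R vb)) - (x - xb))"
      using l by (metis abs_of_pos norm_scaleR)
    also have "\<dots> \<le> norm (x + l *\<^sub>R v - (xb + l *\<^sub>R vb)) + norm (x - xb)" by (rule norm_triangle_ineq4)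
    also have "\<dots> \<le> (1 + M) * s" using lt xM by (simp add: algebra_simps)
    finally have vN: "norm (v - vb) \<le> N * s" using l by (simp add: N_def field_simps)
    then show "norm (v - vb) < \<eta>" using s by simp
    obtain c where c: "f x = ereal c" using ps by (auto simp: prox_subgrad_def)
    have "c + v \<bullet> (xb - x) - (1 / l) / 2 * (norm (xb - x))\<^sup>2 \<le> cb" by (rule prox_subgradD[OF ps c fxb])
    moreover have "- (v \<bullet> (xb - x)) \<le> norm v * norm (x - xb)"
      using norm_cauchy_schwarz[of v "x - xb"] by (simp add: inner_simps)
    moreover have "norm v \<le> norm vb + N * s"
      using norm_triangle_sub[of v vb] vN by simp
    then have "norm v * norm (x - xb) \<le> (norm vb + N * s) * (M * s)"
      by (meson mult_mono xM norm_ge_zero order_trans)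
    moreover have "(1 / l) / 2 * (norm (xb - x))\<^sup>2 \<le> (1 / l) / 2 * (M * s)\<^sup>2"
      using xM l by (intro mult_left_mono power_mono) (auto simp: norm_minus_commute)
    ultimately have "c < cb + \<eta>" using s(4) by linarith
    then show "f x < f xb + ereal \<eta>" by (simp add: c fxb)
  qed (use s in auto)
qed

text \<open>The penalized function attains its minimum on a compact ball around \<open>xb\<close>,
  and by \<open>glob\<close> no point outside the ball has a smaller value than
  \<open>xb\<close>.\<close>

lemma prox_exists: "\<exists>x v. w = x + l *\<^sub>R v \<and> prox_subgrad (1 / l) f x v"
proof -
  define d where "d = w - (xb + l *\<^sub>R vb)"
  \<comment> \<open>Outside the ball of radius \<open>norm d / k\<close> the cross term
    \<open>2 * (d \<bullet> y)\<close> uses up at most \<open>2 * k\<close> of the coefficient 1 of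
    \<open>norm y ^ 2\<close>. The remainder is \<open>l * r\<close>, just what \<open>glob\<close>
    requires.\<close>
  define k where "k = (1 - l * r) / 2"
  have k: "0 < k" using lr by (simp add: k_def)
  let ?F = "\<lambda>z. f z + ereal (1 / (2 * l) * (norm (z - w))\<^sup>2)"
  have cont: "continuous_on UNIV (\<lambda>z. 1 / (2 * l) * (norm (z - w))\<^sup>2)"
    by (intro continuous_intros)
  have F: "lsc ?F" by (rule lsc_add_continuous[OF lsc cont])
  have "cball xb (norm d / k) \<noteq> {}" using k by (simp add: not_less)
  then obtain x where x: "x \<in> cball xb (norm d / k)"
    and min: "\<And>y. y \<in> cball xb (norm d / k) \<Longrightarrow> ?F x \<le> ?F y"
    using lsc_attains_inf[OF F compact_cball] by metis
  have xb: "xb \<in> cball xb (norm d / k)" using k by simp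
  have glob_min: "?F x \<le> ?F z" for z
  proof (cases "z \<in> cball xb (norm d / k)")
    case False
    define y where "y = z - xb"
    have "norm d / k < norm y" using False by (simp add: dist_norm y_def norm_minus_commute)
    then have "norm d < k * norm y" using k by (simp add: field_simps)
    moreover have "0 \<le> norm d / k" using k by simp
    then have "0 < norm y" using \<open>norm d / k < norm y\<close> by linarith
    ultimately have "norm d * norm y < k * norm y * norm y" by (simp only: mult_strict_right_mono)
    moreover have "d \<bullet> y \<le> norm d * norm y" by (rule norm_cauchy_schwarz)
    ultimately have dy: "2 * (d \<bullet> y) \<le> 2 * k * (norm y)\<^sup>2" by (simp add: power2_eq_square)
    have zw: "z - w = y - (l *\<^sub>R vb + d)" and xw: "xb - w = - (l *\<^sub>R vb + d)"
      by (simp_all add: y_def d_def)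
    have "(norm (z - w))\<^sup>2 = (norm y)\<^sup>2 - 2 * (y \<bullet> (l *\<^sub>R vb + d)) + (norm (xb - w))\<^sup>2"
      unfolding zw xw power2_norm_eq_inner by (simp add: inner_simps inner_commute)
    also have "y \<bullet> (l *\<^sub>R vb + d) = l * (vb \<bullet> y) + d \<bullet> y" by (simp add: inner_simps inner_commute)
    finally have "(norm (z - w))\<^sup>2 \<ge> (norm y)\<^sup>2 - 2 * l * (vb \<bullet> y) - 2 * k * (norm y)\<^sup>2 + (norm (xb - w))\<^sup>2"
      using dy by simp
    then have "(norm (z - w))\<^sup>2 \<ge> (norm (xb - w))\<^sup>2 - 2 * l * (vb \<bullet> y) + l * r * (norm y)\<^sup>2"
      by (simp add: k_def algebra_simps diff_divide_distrib)
    then have "1 / (2 * l) * (norm (z - w))\<^sup>2 \<ge>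
        1 / (2 * l) * ((norm (xb - w))\<^sup>2 - 2 * l * (vb \<bullet> y) + l * r * (norm y)\<^sup>2)"
      using l by (intro mult_left_mono) auto
    also have "1 / (2 * l) * ((norm (xb - w))\<^sup>2 - 2 * l * (vb \<bullet> y) + l * r * (norm y)\<^sup>2) =
        1 / (2 * l) * (norm (xb - w))\<^sup>2 - vb \<bullet> y + r / 2 * (norm y)\<^sup>2"
      using l by (simp add: field_simps)
    finally have q: "1 / (2 * l) * (norm (xb - w))\<^sup>2 - vb \<bullet> y + r / 2 * (norm y)\<^sup>2 \<le> 1 / (2 * l) * (norm (z - w))\<^sup>2" .
    have "?F xb \<le> ?F z"
      using glob[of z] q unfolding y_def[symmetric] fxb by (cases "f z") auto
    with min[OF xb] show ?thesis by (rule order_trans)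
  qed (rule min)
  have "?F x \<le> ?F xb" by (rule glob_min)
  then obtain c where c: "f x = ereal c" using not_MInf[of x] by (cases "f x") (auto simp: fxb)
  define v where "v = (1 / l) *\<^sub>R (w - x)"
  have w: "w = x + l *\<^sub>R v" using l by (simp add: v_def)
  have "ereal (c + v \<bullet> (z - x) - (1 / l) / 2 * (norm (z - x))\<^sup>2) \<le> f z" for z
    using glob_min[of z] prox_identity(1)[of l x v] prox_identity(2)[of l z x v] l not_MInf[of z] unfolding w c
    by (cases "f z") (auto simp del: norm_minus_cancel)
  with c w show ?thesis by (auto simp: prox_subgrad_def)
qed

lemma moreau_env_finite: "moreau_env l f w = ereal (real_of_ereal (moreau_env l f w))"
proof -
  obtain x v where w: "w = x + l *\<^sub>R v" and ps: "prox_subgrad (1 / l) f x v" using prox_exists by blast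
  then obtain c where c: "f x = ereal c" by (auto simp: prox_subgrad_def)
  show ?thesis unfolding w prox_subgrad_moreau_env[OF l ps c] by simp
qed

text \<open>The attained and hence finite envelope makes the hull weakly convex with modulus
  \<open>1 / l\<close>, and so its limiting subgradients become global.\<close>

lemma subdiff_hull_iff: "v \<in> subdiff (prox_hull l f) x \<longleftrightarrow> prox_subgrad (1 / l) (prox_hull l f) x v"
  by (rule subdiff_iff_prox_subgrad[OF weakly_convex_prox_hull[OF moreau_env_finite]])

text \<open>This upgrades a local limiting subgradient of \<open>f\<close> to a global proximal one.
  Adding the inequalities of the two pairs with a common centre bounds
  \<open>(1 / l - r) * norm (p - x) ^ 2\<close> by 0.\<close>

lemma prox_unique:
  assumes "v \<in> subdiff f x" "norm (x - xb) < e" "f x < f xb + ereal e" "norm (v - vb) < e" "f x = ereal c"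
    and "prox_subgrad (1 / l) f p q" "norm (p - xb) < e" "p + l *\<^sub>R q = x + l *\<^sub>R v"
  shows "x = p \<and> v = q"
proof -
  obtain d where d: "f p = ereal d" using assms by (auto simp: prox_subgrad_def)
  have 1: "c + v \<bullet> (p - x) - r / 2 * (norm (p - x))\<^sup>2 \<le> d"
    using pr[OF assms(1-4,7,5)] by (simp add: d)
  have 2: "d + q \<bullet> (x - p) - (1 / l) / 2 * (norm (x - p))\<^sup>2 \<le> c" by (rule prox_subgradD[OF assms(6) d assms(5)])
  have "l *\<^sub>R (v - q) = p - x" using assms(8) by (simp add: algebra_simps)
  then have "l * ((v - q) \<bullet> (p - x)) = (norm (p - x))\<^sup>2"
    by (metis inner_scaleR_left power2_norm_eq_inner)
  then have 3: "(v - q) \<bullet> (p - x) = (1 / l) * (norm (p - x))\<^sup>2" using l by (simp add: field_simps)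
  have "(1 / l - r) * (norm (p - x))\<^sup>2 \<le> 0"
    using 1 2 3 by (simp add: inner_simps norm_minus_commute[of x p] algebra_simps)
  moreover have "0 < 1 / l - r" using l lr by (simp add: field_simps)
  ultimately have "p = x" by (simp add: mult_le_0_iff)
  with assms(8) l show ?thesis by simp
qed

text \<open>With both pairs near \<open>(xb, vb)\<close>, adding \<open>pr\<close> in both
  directions gives \<open>(q - v) \<bullet> y \<ge> - r * norm y ^ 2\<close>. Substituting
  \<open>l (q - v) = h - y\<close> yields the estimate.\<close>

lemma prox_lipschitz:
  assumes "prox_subgrad (1 / l) f x v" "norm (x - xb) < e" "f x < f xb + ereal e" "norm (v - vb) < e"
    and "prox_subgrad (1 / l) f p q" "norm (p - xb) < e" "f p < f xb + ereal e" "norm (q - vb) < e"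
  shows "(1 - l * r) * norm (p - x) \<le> norm (p + l *\<^sub>R q - (x + l *\<^sub>R v))"
proof -
  obtain c d where c: "f x = ereal c" and d: "f p = ereal d" using assms(1,5) by (auto simp: prox_subgrad_def)
  define y where "y = p - x"
  define h where "h = p + l *\<^sub>R q - (x + l *\<^sub>R v)"
  have "c + v \<bullet> (p - x) - r / 2 * (norm (p - x))\<^sup>2 \<le> d"
    using pr[OF prox_subgrad_imp_subdiff[OF assms(1)] assms(2-4,6) c] by (simp add: d)
  moreover have "d + q \<bullet> (x - p) - r / 2 * (norm (x - p))\<^sup>2 \<le> c"
    using pr[OF prox_subgrad_imp_subdiff[OF assms(5)] assms(6-8,2) d] by (simp add: c)
  moreover have "q \<bullet> (x - p) = - (q \<bullet> y)" "norm (x - p) = norm y"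
    by (simp_all add: y_def inner_simps norm_minus_commute)
  ultimately have "- r * (norm y)\<^sup>2 \<le> q \<bullet> y - v \<bullet> y" by (simp add: y_def)
  then have "l * (- r * (norm y)\<^sup>2) \<le> l * (q \<bullet> y - v \<bullet> y)" using l by (intro mult_left_mono) auto
  also have "\<dots> = (l *\<^sub>R (q - v)) \<bullet> y" by (simp add: inner_simps)
  also have "l *\<^sub>R (q - v) = h - y" by (simp add: h_def y_def algebra_simps)
  also have "(h - y) \<bullet> y = h \<bullet> y - (norm y)\<^sup>2" by (simp add: inner_diff_left power2_norm_eq_inner)
  finally have "(1 - l * r) * (norm y)\<^sup>2 \<le> h \<bullet> y" by (simp add: algebra_simps)
  also have "\<dots> \<le> norm h * norm y" by (rule norm_cauchy_schwarz)
  finally have "((1 - l * r) * norm y) * norm y \<le> norm h * norm y"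
    by (simp add: power2_eq_square mult.assoc)
  then show ?thesis unfolding y_def[symmetric] h_def[symmetric]
    by (cases "y = 0") (auto simp only: mult_le_cancel_right zero_less_norm_iff norm_zero mult_zero_right norm_ge_zero)
qed

text \<open>Perturbing \<open>w = x + lv\<close> in direction \<open>d\<close> replaces differentiability of the Moreau envelope at \<open>w\<close>:
  it forces a proximal point of \<open>h\<close> to agree with the limit of the proximal points of \<open>f\<close>.\<close>

lemma hull_inner_le_0:
  assumes "prox_subgrad (1 / l) (prox_hull l f) x v" and "prox_subgrad (1 / l) f p q" and "0 < t"
    and "p + l *\<^sub>R q = x + l *\<^sub>R v + t *\<^sub>R d"
  shows "(x - p) \<bullet> d \<le> 0"
proof -
  define w where "w = x + l *\<^sub>R v"
  obtain c where c: "prox_hull l f x = ereal c" using assms(1) by (auto simp: prox_subgrad_def)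
  obtain b where b: "f p = ereal b" using assms(2) by (auto simp: prox_subgrad_def)
  have "ereal (c + l / 2 * (norm v)\<^sup>2) \<le> moreau_env l f w"
    unfolding w_def using not_MInf by (intro prox_subgrad_prox_hull_moreau_env[OF l assms(1) c]) simp
  also have "\<dots> \<le> ereal (b + 1 / (2 * l) * (norm (p - w))\<^sup>2)" by (rule moreau_env_le[of f p b, OF b])
  finally have 1: "c + l / 2 * (norm v)\<^sup>2 \<le> b + 1 / (2 * l) * (norm (p - w))\<^sup>2" by simp
  have 2: "b + l / 2 * (norm q)\<^sup>2 - 1 / (2 * l) * (norm (w + t *\<^sub>R d - x))\<^sup>2 \<le> c"
    using le_prox_hull[of l f "p + l *\<^sub>R q" x] prox_subgrad_moreau_env[OF l assms(2) b]
    unfolding assms(4) c w_def by simp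
  have v: "l / 2 * (norm v)\<^sup>2 = 1 / (2 * l) * (norm (w - x))\<^sup>2"
    using prox_identity(1)[of l x v] l by (simp only: w_def norm_minus_commute[of x])
  have q: "l / 2 * (norm q)\<^sup>2 = 1 / (2 * l) * (norm (w + t *\<^sub>R d - p))\<^sup>2"
    using prox_identity(1)[of l p q] l by (simp only: assms(4) w_def norm_minus_commute[of p])
  \<comment> \<open>Adding both estimates eliminates the values \<open>b\<close> and
    \<open>c\<close>. In the remaining squares the terms quadratic in \<open>t\<close>
    cancel.\<close>
  have "1 / (2 * l) * ((norm (w - x))\<^sup>2 + (norm (w + t *\<^sub>R d - p))\<^sup>2)
      \<le> 1 / (2 * l) * ((norm (w + t *\<^sub>R d - x))\<^sup>2 + (norm (p - w))\<^sup>2)"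
    using 1 2 unfolding v q distrib_left by linarith
  then have 3: "(norm (w - x))\<^sup>2 + (norm (w + t *\<^sub>R d - p))\<^sup>2 \<le> (norm (w + t *\<^sub>R d - x))\<^sup>2 + (norm (w - p))\<^sup>2"
    unfolding norm_minus_commute[of w p] by (rule mult_left_le_imp_le) (use l in simp)
  have ex: "(norm (w + t *\<^sub>R d - u))\<^sup>2 = (norm (w - u))\<^sup>2 + 2 * t * ((w - u) \<bullet> d) + (norm (t *\<^sub>R d))\<^sup>2" for u
  proof -
    have sq: "(norm (a + t *\<^sub>R d))\<^sup>2 = (norm a)\<^sup>2 + 2 * t * (a \<bullet> d) + (norm (t *\<^sub>R d))\<^sup>2" for a
      unfolding power2_norm_eq_inner
      by (simp add: inner_simps inner_commute[of d a] algebra_simps)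
    have "w + t *\<^sub>R d - u = (w - u) + t *\<^sub>R d" by simp
    then show ?thesis by (simp only: sq)
  qed
  have "2 * t * ((w - p) \<bullet> d) \<le> 2 * t * ((w - x) \<bullet> d)" using 3 unfolding ex by linarith
  then have "(w - p) \<bullet> d \<le> (w - x) \<bullet> d" using assms(3) by simp
  then show ?thesis by (simp add: inner_simps)
qed

text \<open>Let \<open>p\<close> be the proximal point of \<open>f\<close> for the centre
  \<open>x + l v\<close>, and let \<open>d = x - p\<close>. Moving the centre by \<open>t d\<close>
  gives a proximal point \<open>p'\<close> with \<open>(x - p') \<bullet> d \<le> 0\<close>, hence
  \<open>norm d ^ 2 \<le> (p' - p) \<bullet> d\<close>. For small \<open>t\<close> the Lipschitz
  bound makes the right-hand side at most half of the left, so \<open>d = 0\<close>.\<close>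

lemma hull_sub_imp_prox:
  "\<exists>\<delta>>0. \<forall>x v. prox_subgrad (1 / l) (prox_hull l f) x v \<and> norm (x + l *\<^sub>R v - (xb + l *\<^sub>R vb)) < \<delta> \<longrightarrow>
    prox_subgrad (1 / l) f x v"
proof -
  obtain \<delta> where \<delta>: "\<delta> > 0" and near: "\<And>x v. prox_subgrad (1 / l) f x v \<Longrightarrow>
      norm (x + l *\<^sub>R v - (xb + l *\<^sub>R vb)) < \<delta> \<Longrightarrow>
      norm (x - xb) < e \<and> norm (v - vb) < e \<and> f x < f xb + ereal e"
    using prox_near[OF e] by blast
  show ?thesis
  proof (intro exI[of _ "\<delta> / 2"] conjI allI impI)
    fix x v assume "prox_subgrad (1 / l) (prox_hull l f) x v \<and> norm (x + l *\<^sub>R v - (xb + l *\<^sub>R vb)) < \<delta> / 2"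
    then have ph: "prox_subgrad (1 / l) (prox_hull l f) x v"
      and lt: "norm (x + l *\<^sub>R v - (xb + l *\<^sub>R vb)) < \<delta> / 2" by auto
    obtain p q where pq: "x + l *\<^sub>R v = p + l *\<^sub>R q" "prox_subgrad (1 / l) f p q" using prox_exists by blast
    define d where "d = x - p"
    \<comment> \<open>The first bound gives \<open>norm (p' - p) \<le> norm d / 2\<close>; the
      second keeps the moved centre within \<delta>, and its summand 1 avoids a division by
      0.\<close>
    define t where "t = min ((1 - l * r) / 2) (\<delta> / (2 * (norm d + 1)))"
    have t: "0 < t" using lr \<delta> by (simp add: t_def add_nonneg_pos)
    have "t \<le> \<delta> / (2 * (norm d + 1))" by (simp add: t_def)
    then have "t * (2 * (norm d + 1)) \<le> \<delta>" by (simp add: pos_le_divide_eq add_nonneg_pos)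
    then have td: "norm (t *\<^sub>R d) < \<delta> / 2" using t by (simp add: algebra_simps)
    obtain p' q' where pq': "x + l *\<^sub>R v + t *\<^sub>R d = p' + l *\<^sub>R q'" "prox_subgrad (1 / l) f p' q'"
      using prox_exists by blast
    have "norm (p + l *\<^sub>R q - (xb + l *\<^sub>R vb)) < \<delta>" using lt \<delta> by (simp add: pq(1))
    note n = near[OF pq(2) this]
    have "norm (x + l *\<^sub>R v + t *\<^sub>R d - (xb + l *\<^sub>R vb)) \<le> norm (x + l *\<^sub>R v - (xb + l *\<^sub>R vb)) + norm (t *\<^sub>R d)"
      by (metis add_diff_eq diff_add_eq norm_triangle_ineq)
    then have "norm (p' + l *\<^sub>R q' - (xb + l *\<^sub>R vb)) < \<delta>" using lt td by (simp add: pq'(1))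
    note n' = near[OF pq'(2) this]
    have "(1 - l * r) * norm (p' - p) \<le> norm (p' + l *\<^sub>R q' - (p + l *\<^sub>R q))"
      using n n' pq pq' by (intro prox_lipschitz) auto
    also have "p' + l *\<^sub>R q' - (p + l *\<^sub>R q) = t *\<^sub>R d" by (simp flip: pq(1) pq'(1))
    also have "norm (t *\<^sub>R d) \<le> (1 - l * r) * (norm d / 2)"
    proof -
      have "t \<le> (1 - l * r) / 2" unfolding t_def by (rule min.cobounded1)
      from mult_right_mono[OF this norm_ge_zero[of d]] show ?thesis using t by simp
    qed
    finally have pp: "norm (p' - p) \<le> norm d / 2" using lr by simp
    have "(x - p') \<bullet> d \<le> 0" using hull_inner_le_0[OF ph pq'(2) t pq'(1)[symmetric]] .
    then have "d \<bullet> d \<le> (p' - p) \<bullet> d" by (simp add: d_def inner_simps)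
    also have "\<dots> \<le> norm (p' - p) * norm d" by (rule norm_cauchy_schwarz)
    also have "\<dots> \<le> norm d / 2 * norm d" using pp by (intro mult_right_mono) auto
    finally have "norm d * norm d \<le> norm d * norm d / 2" by (simp flip: power2_norm_eq_inner power2_eq_square)
    moreover have "0 \<le> norm d * norm d" by simp
    ultimately have "norm d * norm d = 0" by linarith
    then have "x = p" by (simp add: d_def)
    then show "prox_subgrad (1 / l) f x v" using pq l by simp
  qed (use \<delta> in auto)
qed

lemma localization:
  assumes "0 < \<eta>"
  obtains \<delta> where "0 < \<delta>"
    and "\<And>x v. norm (x - xb) < \<delta> \<Longrightarrow> norm (v - vb) < \<delta> \<Longrightarrow> \<exists>p q. x + l *\<^sub>R v = p + l *\<^sub>R q \<and>
      prox_subgrad (1 / l) f p q \<and> norm (p - xb) < \<eta> \<and> norm (q - vb) < \<eta> \<and> f p < f xb + ereal \<eta>"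
    and "\<And>x v. norm (x - xb) < \<delta> \<Longrightarrow> norm (v - vb) < \<delta> \<Longrightarrow> v \<in> subdiff (prox_hull l f) x \<Longrightarrow>
      prox_subgrad (1 / l) f x v \<and> f x < f xb + ereal \<eta>"
proof -
  obtain \<delta>1 where \<delta>1: "\<delta>1 > 0" and near: "\<And>x v. prox_subgrad (1 / l) f x v \<Longrightarrow>
      norm (x + l *\<^sub>R v - (xb + l *\<^sub>R vb)) < \<delta>1 \<Longrightarrow>
      norm (x - xb) < \<eta> \<and> norm (v - vb) < \<eta> \<and> f x < f xb + ereal \<eta>"
    using prox_near[OF assms] by blast
  obtain \<delta>2 where \<delta>2: "\<delta>2 > 0" and hull: "\<And>x v. prox_subgrad (1 / l) (prox_hull l f) x v \<Longrightarrow>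
      norm (x + l *\<^sub>R v - (xb + l *\<^sub>R vb)) < \<delta>2 \<Longrightarrow> prox_subgrad (1 / l) f x v"
    using hull_sub_imp_prox by blast
  \<comment> \<open>The centre \<open>x + l v\<close> moves by less than
    \<open>(1 + l) * \<delta>\<close> when \<open>x\<close> and \<open>v\<close> move by less than
    \<delta>.\<close>
  define \<delta> where "\<delta> = min \<delta>1 \<delta>2 / (1 + l)"
  have \<delta>: "0 < \<delta>" using \<delta>1 \<delta>2 l by (simp add: \<delta>_def)
  have w: "norm (x + l *\<^sub>R v - (xb + l *\<^sub>R vb)) < min \<delta>1 \<delta>2" if "norm (x - xb) < \<delta>" "norm (v - vb) < \<delta>" for x v
  proof -
    have eq: "x + l *\<^sub>R v - (xb + l *\<^sub>R vb) = (x - xb) + l *\<^sub>R (v - vb)" by (simp add: algebra_simps)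
    have "norm (x + l *\<^sub>R v - (xb + l *\<^sub>R vb)) \<le> norm (x - xb) + l * norm (v - vb)"
      unfolding eq using norm_triangle_ineq[of "x - xb" "l *\<^sub>R (v - vb)"] l by simp
    also have "\<dots> < \<delta> + l * \<delta>" using that l by (intro add_strict_mono) auto
    also have "\<dots> = (1 + l) * \<delta>" by (simp add: algebra_simps)
    also have "\<dots> = min \<delta>1 \<delta>2" unfolding \<delta>_def using l by simp
    finally show ?thesis .
  qed
  show ?thesis
  proof (rule that[OF \<delta>])
    fix x v assume xv: "norm (x - xb) < \<delta>" "norm (v - vb) < \<delta>"
    obtain p q where pq: "x + l *\<^sub>R v = p + l *\<^sub>R q" "prox_subgrad (1 / l) f p q" using prox_exists by blast
    then have "norm (p + l *\<^sub>R q - (xb + l *\<^sub>R vb)) < \<delta>1" using w[OF xv] by simp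
    from near[OF pq(2) this] pq show "\<exists>p q. x + l *\<^sub>R v = p + l *\<^sub>R q \<and>
      prox_subgrad (1 / l) f p q \<and> norm (p - xb) < \<eta> \<and> norm (q - vb) < \<eta> \<and> f p < f xb + ereal \<eta>" by blast
    assume "v \<in> subdiff (prox_hull l f) x"
    then have "prox_subgrad (1 / l) (prox_hull l f) x v" by (simp add: subdiff_hull_iff)
    then have "prox_subgrad (1 / l) f x v" using w[OF xv] by (intro hull) simp_all
    with near[OF this] show "prox_subgrad (1 / l) f x v \<and> f x < f xb + ereal \<eta>"
      using w[OF xv] by simp
  qed
qed

section \<open>From the inequality for the hull to variational convexity\<close>

lemma locally_convex_hull_imp_variationally_convex:
  assumes U: "open U" "xb \<in> U" and V: "open V" "vb \<in> V"
    and ineq: "\<And>x v z. v \<in> subdiff (prox_hull l f) x \<Longrightarrow> x \<in> U \<Longrightarrow> v \<in> V \<Longrightarrow> z \<in> U \<Longrightarrow>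
      prox_hull l f z \<ge> prox_hull l f x + ereal (v \<bullet> (z - x))"
  shows "variationally_convex f xb vb"
proof -
  define h where "h = prox_hull l f"
  obtain \<eta> where \<eta>: "0 < \<eta>" "\<eta> \<le> e" "ball xb \<eta> \<subseteq> U" "ball vb \<eta> \<subseteq> V"
    using common_ball_radius[OF U V e] .
  obtain \<delta>1 where \<delta>1: "0 < \<delta>1"
    and loc1: "\<And>x v. norm (x - xb) < \<delta>1 \<Longrightarrow> norm (v - vb) < \<delta>1 \<Longrightarrow> \<exists>p q. x + l *\<^sub>R v = p + l *\<^sub>R q \<and>
      prox_subgrad (1 / l) f p q \<and> norm (p - xb) < \<eta> \<and> norm (q - vb) < \<eta> \<and> f p < f xb + ereal \<eta>"
    by (rule localization[OF \<eta>(1)]) blast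
  \<comment> \<open>Two radii are used: for pairs within \<delta>, the proximal pair with the same
    centre lies within \<eta>, where the assumed inequality is available.\<close>
  define \<delta> where "\<delta> = min \<delta>1 \<eta>"
  have \<delta>: "0 < \<delta>" "\<delta> \<le> \<delta>1" "\<delta> \<le> \<eta>" using \<delta>1 \<eta> by (auto simp: \<delta>_def)
  define A where "A = gph_subdiff h \<inter> (U \<times> V)"
  \<comment> \<open>Subgradients exist only where \<open>h\<close> is finite, so on \<open>A\<close>
    the conversion by \<open>real_of_ereal\<close> loses nothing, and every \<open>F a\<close> is a
    real affine function.\<close>
  define F where "F = (\<lambda>a z. ereal (real_of_ereal (h (fst a)) + snd a \<bullet> (z - fst a)))"
  define fh where "fh = (\<lambda>z. SUP a\<in>A. F a z)"
  have hle: "h z \<le> f z" for z unfolding h_def by (rule prox_hull_le) (rule not_MInf)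
  have fh_le: "fh z \<le> h z" if "z \<in> U" for z
    unfolding fh_def
  proof (rule SUP_least)
    fix a assume "a \<in> A"
    then obtain x v where a: "a = (x, v)" "v \<in> subdiff h x" "x \<in> U" "v \<in> V"
      by (auto simp: A_def gph_subdiff_def)
    then obtain c where "h x = ereal c" using subdiff_hull_iff[of v x] by (auto simp: prox_subgrad_def h_def)
    then show "F a z \<le> h z" using ineq[of v x z] a that by (simp add: F_def h_def)
  qed
  have A_fh: "fh x = h x \<and> prox_subgrad 0 fh x v" if "(x, v) \<in> A" for x v
  proof -
    have xv: "v \<in> subdiff h x" "x \<in> U" using that by (auto simp: A_def gph_subdiff_def)
    then obtain c where c: "h x = ereal c" using subdiff_hull_iff[of v x] by (auto simp: prox_subgrad_def h_def)
    have le: "ereal (c + v \<bullet> (z - x)) \<le> fh z" for z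
      unfolding fh_def using that by (rule SUP_upper2) (simp add: F_def c)
    then have "h x \<le> fh x" using le[of x] by (simp add: c)
    with fh_le[OF xv(2)] have "fh x = h x" by simp
    with le c show ?thesis by (auto simp: prox_subgrad_def)
  qed
  have wF: "weakly_convex 0 (F a)" for a
  proof -
    have "F a = (\<lambda>z. ereal (real_of_ereal (h (fst a)) - snd a \<bullet> fst a + snd a \<bullet> z - 0 / 2 * (norm (z - 0))\<^sup>2))"
      by (simp add: F_def inner_simps fun_eq_iff)
    then show ?thesis using weakly_convex_quadratic by metis
  qed
  have wfh: "weakly_convex 0 fh" unfolding fh_def by (rule weakly_convex_SUP) (rule wF)
  have lfh: "lsc fh" unfolding fh_def F_def
    by (intro lsc_SUP lsc_ereal continuous_intros)
  have prox_A: "(p, q) \<in> A" if "prox_subgrad (1 / l) f p q" "norm (p - xb) < \<eta>" "norm (q - vb) < \<eta>" for p q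
  proof -
    have "p \<in> U" by (rule subsetD[OF \<eta>(3)]) (use that in \<open>simp add: in_ball_norm del: mem_ball\<close>)
    moreover have "q \<in> V" by (rule subsetD[OF \<eta>(4)]) (use that in \<open>simp add: in_ball_norm del: mem_ball\<close>)
    ultimately show ?thesis
      using prox_subgrad_prox_hull(2)[OF l that(1)] by (simp add: A_def gph_subdiff_def h_def subdiff_hull_iff)
  qed
  have left: "(x, v) \<in> A" if xv: "v \<in> subdiff f x" "norm (x - xb) < \<delta>" "f x < f xb + ereal e" "norm (v - vb) < \<delta>" for x v
  proof -
    obtain c where c: "f x = ereal c" using xv(3) not_MInf[of x] by (cases "f x") auto
    obtain p q where pq: "x + l *\<^sub>R v = p + l *\<^sub>R q" "prox_subgrad (1 / l) f p q" "norm (p - xb) < \<eta>" "norm (q - vb) < \<eta>"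
      using loc1[of x v] xv \<delta> by auto
    have "x = p \<and> v = q"
      by (rule prox_unique[OF xv(1) _ xv(3) _ c pq(2)]) (use xv pq \<delta> \<eta> in auto)
    with prox_A pq show ?thesis by blast
  qed
  \<comment> \<open>The pairs \<open>(x, v)\<close> and \<open>(p, q)\<close> share a centre, so
    \<open>l (v - q) = - (x - p)\<close>. Monotonicity of the subgradients of \<open>fh\<close> then
    forces the pairs to coincide, and \<open>fh\<close> has no further subgradients here.\<close>
  have right: "v \<in> subdiff f x \<and> f x < f xb + ereal e \<and> f x = fh x"
    if xv: "v \<in> subdiff fh x" "norm (x - xb) < \<delta>" "norm (v - vb) < \<delta>" for x v
  proof -
    obtain p q where pq: "x + l *\<^sub>R v = p + l *\<^sub>R q" "prox_subgrad (1 / l) f p q" "norm (p - xb) < \<eta>" "norm (q - vb) < \<eta>"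
      "f p < f xb + ereal \<eta>" using loc1[of x v] xv \<delta> by auto
    have pA: "(p, q) \<in> A" using prox_A pq by blast
    have "prox_subgrad 0 fh x v" using xv(1) subdiff_iff_prox_subgrad[OF wfh] by blast
    then have "0 \<le> (v - q) \<bullet> (x - p)" by (rule prox_subgrad_0_mono) (use A_fh[OF pA] in blast)
    then have "0 \<le> l * ((v - q) \<bullet> (x - p))" using l by simp
    also have "\<dots> = (l *\<^sub>R (v - q)) \<bullet> (x - p)" by simp
    also have "l *\<^sub>R (v - q) = - (x - p)" using pq(1) by (simp add: algebra_simps)
    finally have "(norm (x - p))\<^sup>2 \<le> 0"
      by (simp add: inner_minus_left power2_norm_eq_inner del: minus_diff_eq)
    then have "x = p" by simp
    then have vq: "v = q" using pq(1) l by simp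
    have "f xb + ereal \<eta> \<le> f xb + ereal e" using \<eta>(2) by (intro add_left_mono) simp
    then have "f x < f xb + ereal e" using pq(5) \<open>x = p\<close> by simp
    moreover have "f x = fh x" using A_fh[OF pA] prox_subgrad_prox_hull(1)[OF l pq(2)] \<open>x = p\<close> by (simp add: h_def)
    ultimately show ?thesis using prox_subgrad_imp_subdiff[OF pq(2)] \<open>x = p\<close> vq by blast
  qed
  have eq: "({x \<in> ball xb \<delta>. f x < f xb + ereal e} \<times> ball vb \<delta>) \<inter> gph_subdiff f = (ball xb \<delta> \<times> ball vb \<delta>) \<inter> gph_subdiff fh"
  proof (intro equalityI subsetI)
    fix a assume "a \<in> ({x \<in> ball xb \<delta>. f x < f xb + ereal e} \<times> ball vb \<delta>) \<inter> gph_subdiff f"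
    then obtain x v where a: "a = (x, v)" "x \<in> ball xb \<delta>" "f x < f xb + ereal e" "v \<in> ball vb \<delta>" "v \<in> subdiff f x"
      by (auto simp: gph_subdiff_def)
    then have "(x, v) \<in> A" by (intro left) (auto simp: in_ball_norm simp del: mem_ball)
    then have "v \<in> subdiff fh x" using A_fh prox_subgrad_imp_subdiff by blast
    with a show "a \<in> (ball xb \<delta> \<times> ball vb \<delta>) \<inter> gph_subdiff fh" by (simp add: gph_subdiff_def)
  next
    fix a assume "a \<in> (ball xb \<delta> \<times> ball vb \<delta>) \<inter> gph_subdiff fh"
    then obtain x v where a: "a = (x, v)" "x \<in> ball xb \<delta>" "v \<in> ball vb \<delta>" "v \<in> subdiff fh x"
      by (auto simp: gph_subdiff_def)
    then have "norm (x - xb) < \<delta>" "norm (v - vb) < \<delta>" by (simp_all only: in_ball_norm)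
    from right[OF a(4) this] have "v \<in> subdiff f x" "f x < f xb + ereal e" by blast+
    with a show "a \<in> ({x \<in> ball xb \<delta>. f x < f xb + ereal e} \<times> ball vb \<delta>) \<inter> gph_subdiff f"
      by (simp add: gph_subdiff_def)
  qed
  have fheq: "\<forall>(x, v) \<in> (ball xb \<delta> \<times> ball vb \<delta>) \<inter> gph_subdiff fh. f x = fh x"
    using right by (auto simp: gph_subdiff_def in_ball_norm simp del: mem_ball)
  have "ball xb \<delta> \<subseteq> U" using \<delta>(3) \<eta>(3) by (meson order_trans subset_ball)
  then have "\<forall>x\<in>ball xb \<delta>. fh x \<le> f x" using fh_le hle order_trans by blast
  moreover have "convex_ext fh" using wfh by (simp add: weakly_convex_0)
  moreover have "proper f" unfolding proper_def
  proof
    show "\<forall>x. -\<infinity> < f x" using not_MInf by simp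
    show "\<exists>x. f x \<noteq> \<infinity>" using fxb by (intro exI[of _ xb]) simp
  qed
  moreover have "xb \<in> edom f" by (simp add: edom_def fxb)
  moreover have "vb \<in> subdiff f xb" by (rule prox_subgrad_imp_subdiff[OF prox_subgrad_xb])
  ultimately show ?thesis
    unfolding variationally_convex_def using lsc lfh \<delta>(1) e eq fheq
    by (intro conjI exI[of _ "ball xb \<delta>"] exI[of _ "ball vb \<delta>"] exI[of _ fh] exI[of _ e])
      simp_all
qed

section \<open>From variational convexity to the inequality for the hull\<close>

lemma variationally_convex_imp_locally_convex_hull:
  assumes "variationally_convex f xb vb"
  shows "\<exists>U V. open U \<and> convex U \<and> xb \<in> U \<and> open V \<and> convex V \<and> vb \<in> V \<and>
    (\<forall>(x, v) \<in> gph_subdiff (prox_hull l f) \<inter> (U \<times> V).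
      \<forall>z\<in>U. prox_hull l f z \<ge> prox_hull l f x + ereal (v \<bullet> (z - x)))"
proof -
  obtain U V fh \<epsilon> where UV: "open U" "xb \<in> U" "open V" "vb \<in> V"
    and cfh: "convex_ext fh" and fhle: "\<And>x. x \<in> U \<Longrightarrow> fh x \<le> f x" and \<epsilon>: "\<epsilon> > 0"
    and gph: "({x \<in> U. f x < f xb + ereal \<epsilon>} \<times> V) \<inter> gph_subdiff f = (U \<times> V) \<inter> gph_subdiff fh"
    and feq: "\<forall>(x, v) \<in> (U \<times> V) \<inter> gph_subdiff fh. f x = fh x"
    using assms unfolding variationally_convex_def by blast
  obtain \<eta> where \<eta>: "0 < \<eta>" "\<eta> \<le> \<epsilon>" "ball xb \<eta> \<subseteq> U" "ball vb \<eta> \<subseteq> V"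
    using common_ball_radius[OF UV \<epsilon>] .
  obtain \<delta>1 where \<delta>1: "0 < \<delta>1"
    and loc1: "\<And>x v. norm (x - xb) < \<delta>1 \<Longrightarrow> norm (v - vb) < \<delta>1 \<Longrightarrow> \<exists>p q. x + l *\<^sub>R v = p + l *\<^sub>R q \<and>
      prox_subgrad (1 / l) f p q \<and> norm (p - xb) < \<eta> \<and> norm (q - vb) < \<eta> \<and> f p < f xb + ereal \<eta>"
    and loc2: "\<And>x v. norm (x - xb) < \<delta>1 \<Longrightarrow> norm (v - vb) < \<delta>1 \<Longrightarrow> v \<in> subdiff (prox_hull l f) x \<Longrightarrow>
      prox_subgrad (1 / l) f x v \<and> f x < f xb + ereal \<eta>"
    by (rule localization[OF \<eta>(1)]) blast
  define \<delta> where "\<delta> = min \<delta>1 \<eta>"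
  have \<delta>: "0 < \<delta>" "\<delta> \<le> \<delta>1" "\<delta> \<le> \<eta>" using \<delta>1 \<eta> by (auto simp: \<delta>_def)
  have main: "prox_hull l f x + ereal (v \<bullet> (z - x)) \<le> prox_hull l f z"
    if xv: "v \<in> subdiff (prox_hull l f) x" "norm (x - xb) < \<delta>" "norm (v - vb) < \<delta>" and z: "norm (z - xb) < \<delta>" for x v z
  proof -
    have ps: "prox_subgrad (1 / l) f x v" and fx: "f x < f xb + ereal \<eta>" using loc2[of x v] xv \<delta> by auto
    obtain c where c: "f x = ereal c" using ps by (auto simp: prox_subgrad_def)
    have "f xb + ereal \<eta> \<le> f xb + ereal \<epsilon>" using \<eta>(2) by (intro add_left_mono) simp
    then have "f x < f xb + ereal \<epsilon>" using fx by simp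
    moreover have "x \<in> U" by (rule subsetD[OF \<eta>(3)]) (use xv \<delta> in \<open>simp add: in_ball_norm del: mem_ball\<close>)
    moreover have "v \<in> V" by (rule subsetD[OF \<eta>(4)]) (use xv \<delta> in \<open>simp add: in_ball_norm del: mem_ball\<close>)
    moreover have "v \<in> subdiff f x" using ps by (rule prox_subgrad_imp_subdiff)
    \<comment> \<open>Equality of the graphs turns the subgradient of \<open>f\<close> into a
      convex, hence global, subgradient of \<open>fh\<close>; \<open>fh \<le> f\<close> on
      \<open>U\<close> carries its inequality back to \<open>f\<close>.\<close>
    ultimately have g: "(x, v) \<in> (U \<times> V) \<inter> gph_subdiff fh"
      unfolding gph[symmetric] by (simp add: gph_subdiff_def)
    then have "prox_subgrad 0 fh x v"
      using subdiff_iff_prox_subgrad[of 0 fh v x] cfh by (simp add: weakly_convex_0 gph_subdiff_def)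
    moreover have "fh x = ereal c" using bspec[OF feq g] c by simp
    ultimately have le: "ereal (c + v \<bullet> (y - x)) \<le> fh y" for y
      by (auto simp: prox_subgrad_def)
    \<comment> \<open>The centre is built with the same \<open>v\<close>. The difference of the
      penalties at \<open>p\<close> and \<open>z\<close> then contains
      \<open>- v \<bullet> (p - z)\<close>, which completes \<open>v \<bullet> (p - x)\<close> to
      \<open>v \<bullet> (z - x)\<close>; the rest is a nonnegative square.\<close>
    obtain p q where pq: "z + l *\<^sub>R v = p + l *\<^sub>R q" "prox_subgrad (1 / l) f p q" "norm (p - xb) < \<eta>"
      using loc1[of z v] xv z \<delta> by auto
    obtain b where b: "f p = ereal b" using pq(2) by (auto simp: prox_subgrad_def)
    have "p \<in> U" by (intro subsetD[OF \<eta>(3)]) (use pq in \<open>simp add: in_ball_norm del: mem_ball\<close>)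
    then have 1: "c + v \<bullet> (p - x) \<le> b"
      using order_trans[OF le[of p] fhle[of p]] by (simp add: b)
    have "b + l / 2 * (norm q)\<^sup>2 - 1 / (2 * l) * (norm (z - (z + l *\<^sub>R v)))\<^sup>2 \<le> prox_hull l f z"
      using le_prox_hull[of l f "p + l *\<^sub>R q" z] prox_subgrad_moreau_env[OF l pq(2) b]
      unfolding pq(1)[symmetric] by (simp only: norm_minus_commute[of z] ereal_minus(1))
    moreover have "l / 2 * (norm q)\<^sup>2 = 1 / (2 * l) * (norm (p - (z + l *\<^sub>R v)))\<^sup>2"
      using prox_identity(1)[of l p q] l unfolding pq(1) by simp
    moreover have "1 / (2 * l) * (norm (z - (z + l *\<^sub>R v)))\<^sup>2 = l / 2 * (norm v)\<^sup>2"
      using prox_identity(1)[of l z v] l by simp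
    moreover have "1 / (2 * l) * (norm (p - (z + l *\<^sub>R v)))\<^sup>2 =
        l / 2 * (norm v)\<^sup>2 - v \<bullet> (p - z) + (1 / l) / 2 * (norm (p - z))\<^sup>2"
      using prox_identity(2)[of l p z v] l by simp
    moreover have "0 \<le> (1 / l) / 2 * (norm (p - z))\<^sup>2" using l by simp
    moreover have "v \<bullet> (p - x) - v \<bullet> (p - z) = v \<bullet> (z - x)" by (simp add: inner_simps)
    ultimately have "ereal (b - v \<bullet> (p - z) + (1 / l) / 2 * (norm (p - z))\<^sup>2) \<le> prox_hull l f z"
      by (simp only: add_diff_eq) (simp add: algebra_simps)
    moreover have "c + v \<bullet> (z - x) \<le> b - v \<bullet> (p - z) + (1 / l) / 2 * (norm (p - z))\<^sup>2"
      using 1 \<open>0 \<le> (1 / l) / 2 * (norm (p - z))\<^sup>2\<close> \<open>v \<bullet> (p - x) - v \<bullet> (p - z) = v \<bullet> (z - x)\<close> by linarith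
    ultimately have "ereal (c + v \<bullet> (z - x)) \<le> prox_hull l f z"
      by (meson ereal_less_eq(3) order_trans)
    then show ?thesis using prox_subgrad_prox_hull(1)[OF l ps] by (simp add: c)
  qed
  show ?thesis
    by (intro exI[of _ "ball xb \<delta>"] exI[of _ "ball vb \<delta>"])
      (use \<delta>(1) main in \<open>auto simp: gph_subdiff_def in_ball_norm simp del: mem_ball\<close>)
qed

end

section \<open>Obtaining the setting from prox-regularity and prox-boundedness\<close>

lemma prox_bounded_quadratic_minorant:
  assumes "prox_bounded f"
  shows "\<exists>m>0. \<exists>a C. \<forall>z. ereal (C - 1 / (2 * m) * (norm (z - a))\<^sup>2) \<le> f z"
proof -
  obtain m a where m: "0 < m" "moreau_env m f a > -\<infinity>" using assms by (auto simp: prox_bounded_def)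
  obtain C where C: "ereal C < moreau_env m f a" using ereal_dense2[OF m(2)] by auto
  have "ereal (C - 1 / (2 * m) * (norm (z - a))\<^sup>2) \<le> f z" for z
  proof -
    have "ereal C \<le> f z + ereal (1 / (2 * m) * (norm (z - a))\<^sup>2)"
      by (rule order_trans[OF less_imp_le[OF C]]) (unfold moreau_env_def, rule INF_lower, simp)
    then show ?thesis by (cases "f z") auto
  qed
  with m(1) show ?thesis by blast
qed

text \<open>Prox-regularity gives the inequality at \<open>(xb, vb)\<close> within distance
  \<open>e\<close>. Farther away the quadratic minorant from prox-boundedness suffices once
  \<open>r\<close> is enlarged.\<close>

lemma prox_regular_setting:
  fixes f :: "'a::euclidean_space \<Rightarrow> ereal"
  assumes "prox_regular f xb vb" "prox_bounded f"
  shows "\<exists>cb e r. \<exists>l0>0. \<forall>l. 0 < l \<and> l < l0 \<longrightarrow> prox_setting f xb vb cb e r l"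
proof -
  obtain e r0 where e: "0 < e" and r0: "0 \<le> r0" and
    reg: "\<And>x v z. v \<in> subdiff f x \<Longrightarrow> norm (x - xb) < e \<Longrightarrow> f x < f xb + ereal e \<Longrightarrow>
      norm (v - vb) < e \<Longrightarrow> norm (z - xb) < e \<Longrightarrow>
      f z \<ge> f x + ereal (v \<bullet> (z - x)) - ereal (r0 / 2 * (norm (z - x))\<^sup>2)"
    using assms(1) by (auto simp: prox_regular_def gph_subdiff_def)
  have f: "proper f" "lsc f" "xb \<in> edom f" "vb \<in> subdiff f xb"
    using assms(1) by (auto simp: prox_regular_def)
  then obtain cb where cb: "f xb = ereal cb"
    by (cases "f xb") (auto simp: proper_def edom_def)
  obtain m a C where m: "0 < m" and C: "\<And>z. ereal (C - 1 / (2 * m) * (norm (z - a))\<^sup>2) \<le> f z"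
    using prox_bounded_quadratic_minorant[OF assms(2)] by blast
  define D where "D = norm (xb - a)"
  \<comment> \<open>Where \<open>norm (z - xb) \<ge> e\<close>, constants are absorbed through
    \<open>1 \<le> n\<^sup>2 / e\<^sup>2\<close>. The summands pay for the gap
    \<open>cb - C\<close>, the linear term, the curvature of the minorant and the offset of its
    centre from \<open>xb\<close>.\<close>
  define R where "R = \<bar>cb - C\<bar> / e\<^sup>2 + norm vb / e + 1 / m + D\<^sup>2 / m / e\<^sup>2"
  define r where "r = r0 + 2 * R"
  have R: "0 \<le> R" using e m by (simp add: R_def)
  have glob: "ereal (cb + vb \<bullet> (z - xb) - r / 2 * (norm (z - xb))\<^sup>2) \<le> f z" for z
  proof (cases "norm (z - xb) < e")
    case True
    have "f xb + ereal (vb \<bullet> (z - xb)) - ereal (r0 / 2 * (norm (z - xb))\<^sup>2) \<le> f z"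
      using reg[OF f(4)] e True by (simp add: cb)
    moreover have "r0 / 2 * (norm (z - xb))\<^sup>2 \<le> r / 2 * (norm (z - xb))\<^sup>2"
      using R by (intro mult_right_mono) (auto simp: r_def)
    then have "ereal (cb + vb \<bullet> (z - xb) - r / 2 * (norm (z - xb))\<^sup>2) \<le>
        f xb + ereal (vb \<bullet> (z - xb)) - ereal (r0 / 2 * (norm (z - xb))\<^sup>2)"
      by (simp add: cb)
    ultimately show ?thesis by (rule order_trans[rotated])
  next
    case False
    define n where "n = norm (z - xb)"
    have n: "e \<le> n" "0 < n" using False e by (auto simp: n_def)
    have ne: "1 \<le> n\<^sup>2 / e\<^sup>2" using n e by (simp add: power_mono)
    have "norm (z - a) \<le> n + D"
      unfolding n_def D_def using norm_triangle_ineq[of "z - xb" "xb - a"] by simp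
    then have "(norm (z - a))\<^sup>2 \<le> (n + D)\<^sup>2" by (intro power_mono) auto
    also have "\<dots> \<le> 2 * (n\<^sup>2 + D\<^sup>2)"
      using zero_le_power2[of "n - D"] by (simp add: power2_sum power2_diff)
    finally have "1 / (2 * m) * (norm (z - a))\<^sup>2 \<le> 1 / (2 * m) * (2 * (n\<^sup>2 + D\<^sup>2))"
      using m by (intro mult_left_mono) auto
    also have "\<dots> = 1 / m * n\<^sup>2 + D\<^sup>2 / m" using m by (simp add: field_simps)
    finally have 1: "1 / (2 * m) * (norm (z - a))\<^sup>2 \<le> 1 / m * n\<^sup>2 + D\<^sup>2 / m" .
    have 2: "D\<^sup>2 / m \<le> D\<^sup>2 / m / e\<^sup>2 * n\<^sup>2"
      using mult_left_mono[OF ne, of "D\<^sup>2 / m"] m by simp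
    have 3: "cb - C \<le> \<bar>cb - C\<bar> / e\<^sup>2 * n\<^sup>2"
      using mult_left_mono[OF ne, of "\<bar>cb - C\<bar>"] by simp
    have "vb \<bullet> (z - xb) \<le> norm vb * n" unfolding n_def by (rule norm_cauchy_schwarz)
    also have "\<dots> \<le> norm vb * (n / e * n)"
      using n e by (intro mult_left_mono) (auto simp: field_simps)
    finally have 4: "vb \<bullet> (z - xb) \<le> norm vb / e * n\<^sup>2" by (simp add: power2_eq_square)
    have "0 \<le> r0 / 2 * n\<^sup>2" using r0 by simp
    moreover have "r / 2 * n\<^sup>2 = r0 / 2 * n\<^sup>2 + \<bar>cb - C\<bar> / e\<^sup>2 * n\<^sup>2 + norm vb / e * n\<^sup>2 + 1 / m * n\<^sup>2 + D\<^sup>2 / m / e\<^sup>2 * n\<^sup>2"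
      by (simp only: r_def R_def) (simp add: algebra_simps add_divide_distrib)
    ultimately have "cb + vb \<bullet> (z - xb) - r / 2 * n\<^sup>2 \<le> C - 1 / (2 * m) * (norm (z - a))\<^sup>2"
      using 1 2 3 4 by linarith
    then have "ereal (cb + vb \<bullet> (z - xb) - r / 2 * n\<^sup>2) \<le> ereal (C - 1 / (2 * m) * (norm (z - a))\<^sup>2)" by simp
    with C[of z] show ?thesis unfolding n_def by (meson order_trans)
  qed
  have pr: "ereal (c + v \<bullet> (z - x) - r / 2 * (norm (z - x))\<^sup>2) \<le> f z"
    if "v \<in> subdiff f x" "norm (x - xb) < e" "f x < f xb + ereal e" "norm (v - vb) < e"
      "norm (z - xb) < e" "f x = ereal c" for x v c z
  proof -
    have "r0 / 2 * (norm (z - x))\<^sup>2 \<le> r / 2 * (norm (z - x))\<^sup>2"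
      using R by (intro mult_right_mono) (auto simp: r_def)
    then have "ereal (c + v \<bullet> (z - x) - r / 2 * (norm (z - x))\<^sup>2) \<le>
        f x + ereal (v \<bullet> (z - x)) - ereal (r0 / 2 * (norm (z - x))\<^sup>2)"
      by (simp add: that(6))
    also have "\<dots> \<le> f z" by (rule reg[OF that(1-5)])
    finally show ?thesis .
  qed
  have r: "0 \<le> r" using r0 R by (simp add: r_def)
  show ?thesis
  \<comment> \<open>The threshold \<open>1 / (r + 1)\<close> yields \<open>l * r < 1\<close> and is
    also defined for \<open>r = 0\<close>.\<close>
  proof (rule exI[of _ cb], rule exI[of _ e], rule exI[of _ r], intro exI[of _ "1 / (r + 1)"] conjI allI impI)
    show "0 < 1 / (r + 1)" using r by simp
    fix l assume l: "0 < l \<and> l < 1 / (r + 1)"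
    then have "l * (r + 1) < 1" using r by (simp add: pos_less_divide_eq)
    then have "l * r < 1" using l by (simp add: distrib_left)
    then show "prox_setting f xb vb cb e r l"
      using l e r cb f(2) glob pr by unfold_locales auto
  qed
qed

text \<open>Prox-regularity holds with \<open>r = 0\<close>: subgradients on the common graph
  satisfy the convex inequality for \<open>fh\<close>, which touches \<open>f\<close> at
  \<open>x\<close> and lies below it on \<open>U\<close>.\<close>

lemma variationally_convex_imp_prox_regular:
  fixes f :: "'a::euclidean_space \<Rightarrow> ereal"
  assumes "variationally_convex f xb vb"
  shows "prox_regular f xb vb"
proof -
  obtain U V fh \<epsilon> where UV: "open U" "xb \<in> U" "open V" "vb \<in> V"
    and cfh: "convex_ext fh" and fhle: "\<And>x. x \<in> U \<Longrightarrow> fh x \<le> f x" and \<epsilon>: "\<epsilon> > 0"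
    and gph: "({x \<in> U. f x < f xb + ereal \<epsilon>} \<times> V) \<inter> gph_subdiff f = (U \<times> V) \<inter> gph_subdiff fh"
    and feq: "\<forall>(x, v) \<in> (U \<times> V) \<inter> gph_subdiff fh. f x = fh x"
    using assms unfolding variationally_convex_def by blast
  obtain \<eta> where \<eta>: "0 < \<eta>" "\<eta> \<le> \<epsilon>" "ball xb \<eta> \<subseteq> U" "ball vb \<eta> \<subseteq> V"
    using common_ball_radius[OF UV \<epsilon>] .
  have inU: "x \<in> U" if "norm (x - xb) < \<eta>" for x
    by (rule subsetD[OF \<eta>(3)]) (use that in \<open>simp add: in_ball_norm del: mem_ball\<close>)
  have inV: "v \<in> V" if "norm (v - vb) < \<eta>" for v
    by (rule subsetD[OF \<eta>(4)]) (use that in \<open>simp add: in_ball_norm del: mem_ball\<close>)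
  have "f x + ereal (v \<bullet> (z - x)) \<le> f z"
    if "v \<in> subdiff f x" "norm (x - xb) < \<eta>" "f x < f xb + ereal \<eta>" "norm (v - vb) < \<eta>" "norm (z - xb) < \<eta>" for x v z
  proof -
    have "f xb + ereal \<eta> \<le> f xb + ereal \<epsilon>" using \<eta>(2) by (intro add_left_mono) simp
    then have "f x < f xb + ereal \<epsilon>" using that(3) by simp
    then have g: "(x, v) \<in> (U \<times> V) \<inter> gph_subdiff fh"
      unfolding gph[symmetric] using that inU inV by (simp add: gph_subdiff_def)
    then have "prox_subgrad 0 fh x v"
      using subdiff_iff_prox_subgrad[of 0 fh v x] cfh by (simp add: weakly_convex_0 gph_subdiff_def)
    then obtain c where c: "fh x = ereal c" "\<And>y. ereal (c + v \<bullet> (y - x)) \<le> fh y"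
      by (auto simp: prox_subgrad_def)
    have "f x = ereal c" using bspec[OF feq g] c(1) by simp
    then show ?thesis using order_trans[OF c(2)[of z] fhle[OF inU[OF that(5)]]] by simp
  qed
  then have "\<exists>\<epsilon>>0. \<exists>r\<ge>0. \<forall>(x, v)\<in>gph_subdiff f.
        norm (x - xb) < \<epsilon> \<and> f x < f xb + ereal \<epsilon> \<and> norm (v - vb) < \<epsilon> \<longrightarrow>
        (\<forall>x'. norm (x' - xb) < \<epsilon> \<longrightarrow>
           f x' \<ge> f x + ereal (v \<bullet> (x' - x)) - ereal (r / 2 * (norm (x' - x))\<^sup>2))"
    using \<eta>(1) by (intro exI[of _ \<eta>] conjI exI[of _ 0]) (auto simp: gph_subdiff_def simp flip: zero_ereal_def)
  then show ?thesis using assms unfolding variationally_convex_def prox_regular_def by blast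
qed

theorem theorem3p2:
  fixes f :: "real ^ 'n \<Rightarrow> ereal" and xb vb :: "real ^ 'n"
  assumes "proper f" and "lsc f" and "prox_bounded f"
    and "xb \<in> edom f" and "vb \<in> subdiff f xb"
  shows "variationally_convex f xb vb \<longleftrightarrow>
    prox_regular f xb vb \<and>
    (\<exists>l0>0. \<forall>l. 0 < l \<and> l < l0 \<longrightarrow>
      (\<exists>U V. open U \<and> convex U \<and> xb \<in> U \<and> open V \<and> convex V \<and> vb \<in> V \<and>
        (\<forall>(x, v) \<in> gph_subdiff (prox_hull l f) \<inter> (U \<times> V).
          \<forall>z\<in>U. prox_hull l f z \<ge> prox_hull l f x + ereal (v \<bullet> (z - x)))))"
proof
  assume vc: "variationally_convex f xb vb"
  then have pr: "prox_regular f xb vb" by (rule variationally_convex_imp_prox_regular)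
  obtain cb e r l0 where "l0 > 0" and setting: "\<And>l. 0 < l \<and> l < l0 \<Longrightarrow> prox_setting f xb vb cb e r l"
    using prox_regular_setting[OF pr assms(3)] by blast
  show "prox_regular f xb vb \<and> (\<exists>l0>0. \<forall>l. 0 < l \<and> l < l0 \<longrightarrow>
      (\<exists>U V. open U \<and> convex U \<and> xb \<in> U \<and> open V \<and> convex V \<and> vb \<in> V \<and>
        (\<forall>(x, v) \<in> gph_subdiff (prox_hull l f) \<inter> (U \<times> V).
          \<forall>z\<in>U. prox_hull l f z \<ge> prox_hull l f x + ereal (v \<bullet> (z - x)))))"
    by (rule conjI[OF pr], rule exI[of _ l0], rule conjI[OF \<open>l0 > 0\<close>], intro allI impI)
      (rule prox_setting.variationally_convex_imp_locally_convex_hull[OF setting vc])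
next
  assume ii: "prox_regular f xb vb \<and> (\<exists>l0>0. \<forall>l. 0 < l \<and> l < l0 \<longrightarrow>
      (\<exists>U V. open U \<and> convex U \<and> xb \<in> U \<and> open V \<and> convex V \<and> vb \<in> V \<and>
        (\<forall>(x, v) \<in> gph_subdiff (prox_hull l f) \<inter> (U \<times> V).
          \<forall>z\<in>U. prox_hull l f z \<ge> prox_hull l f x + ereal (v \<bullet> (z - x)))))"
  obtain cb e r l1 where l1: "l1 > 0" "\<And>l. 0 < l \<and> l < l1 \<Longrightarrow> prox_setting f xb vb cb e r l"
    using prox_regular_setting[of f xb vb] ii assms(3) by blast
  obtain l0 where l0: "l0 > 0" "\<And>l. 0 < l \<and> l < l0 \<Longrightarrow>
      (\<exists>U V. open U \<and> convex U \<and> xb \<in> U \<and> open V \<and> convex V \<and> vb \<in> V \<and>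
        (\<forall>(x, v) \<in> gph_subdiff (prox_hull l f) \<inter> (U \<times> V).
          \<forall>z\<in>U. prox_hull l f z \<ge> prox_hull l f x + ereal (v \<bullet> (z - x))))"
    using ii by blast
  \<comment> \<open>A single parameter suffices for this implication; it lies below both the
    threshold of the hypothesis and that of the setting.\<close>
  define l where "l = min l0 l1 / 2"
  have l_less: "0 < l" "l < l0" "l < l1" using l0(1) l1(1) by (auto simp: l_def)
  interpret prox_setting f xb vb cb e r l using l1(2) l_less by blast
  obtain U V where UV: "open U" "xb \<in> U" "open V" "vb \<in> V" and
    ineq: "\<forall>(x, v) \<in> gph_subdiff (prox_hull l f) \<inter> (U \<times> V).
          \<forall>z\<in>U. prox_hull l f z \<ge> prox_hull l f x + ereal (v \<bullet> (z - x))"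
    using l0(2)[OF conjI[OF l_less(1,2)]] by (elim exE conjE) (rule that)
  show "variationally_convex f xb vb"
  proof (rule locally_convex_hull_imp_variationally_convex[OF UV])
    fix x v z assume "v \<in> subdiff (prox_hull l f) x" "x \<in> U" "v \<in> V" "z \<in> U"
    then show "prox_hull l f x + ereal (v \<bullet> (z - x)) \<le> prox_hull l f z"
      using bspec[OF ineq, of "(x, v)"] by (simp add: gph_subdiff_def)
  qed
qed

end
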